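(* Let $\rho,\sigma_1,\ldots,\sigma_r$ be density operators on a finite-dimensional Hilbert space $\mathcal{H}$, let $0<p<1$, and let $(q_1,\ldots,q_r)$ be a probability distribution with $q_i>0$ for all $i$. Then $$-\min_iC(\rho,\sigma_i)\le\liminf_{n\to\infty}\frac1n\log P_e^*\Big(p\rho^{\otimes n},(1-p)\sum_iq_i\sigma_i^{\otimes n}\Big)$$ $$\le\limsup_{n\to\infty}\frac1n\log P_e^*\Big(p\rho^{\otimes n},(1-p)\sum_iq_i\sigma_i^{\otimes n}\Big)\le-\frac12\min_iC(\rho,\sigma_i).$$ If $\rho$ is pure (i.e. of rank one) then $$\lim_{n\to\infty}\frac1n\log P_e^*\Big(p\rho^{\otimes n},(1-p)\sum_iq_i\sigma_i^{\otimes n}\Big)=-\min_iC(\rho,\sigma_i).$$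
   Context: For positive semidefinite operators $A,B$ on a finite-dimensional Hilbert space, $P_e^*(A,B):=\min\{\operatorname{Tr}A(I-E)+\operatorname{Tr}BE:\,0\le E\le I\}=\frac12\operatorname{Tr}(A+B)-\frac12\|A-B\|_1$, where $\|\cdot\|_1$ is the trace norm. The Chernoff divergence is $C(A,B):=-\log\min_{0\le s\le1}\operatorname{Tr}A^sB^{1-s}$, where powers of a positive semidefinite operator are taken only on its support (so $A^0$ is the projection onto the support of $A$). The logarithm has a fixed base larger than $1$, with $\log0:=-\infty$. *)

theory Defs
  imports
    "HOL-Library.Extended_Real"
    "HOL-Library.Liminf_Limsup"
    "Jordan_Normal_Form.Schur_Decomposition"
    "Jordan_Normal_Form.DL_Rank"
begin

text \<open>
  A \<open>d\<close>-dimensional Hilbert space is represented, by a choice of orthonormal basis, as complex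
  column vectors of length \<open>d\<close>, and its operators as complex \<open>d \<times> d\<close> matrices. The \<open>n\<close>-fold
  tensor power of the space then has dimension \<open>d ^ n\<close>.
\<close>

definition psd :: "nat \<Rightarrow> complex mat \<Rightarrow> bool" where
  "psd d A \<longleftrightarrow> A \<in> carrier_mat d d \<and> mat_adjoint A = A \<and>
     (\<forall>v \<in> carrier_vec d. 0 \<le> (A *\<^sub>v v) \<bullet>c v)"

definition op_trace :: "complex mat \<Rightarrow> complex" where
  "op_trace A = (\<Sum>i<dim_row A. A $$ (i, i))"

definition density_op :: "nat \<Rightarrow> complex mat \<Rightarrow> bool" where
  "density_op d A \<longleftrightarrow> psd d A \<and> op_trace A = 1"

definition unitary_op :: "nat \<Rightarrow> complex mat \<Rightarrow> bool" where
  "unitary_op d U \<longleftrightarrow> U \<in> carrier_mat d d \<and>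
     mat_adjoint U * U = 1\<^sub>m d \<and> U * mat_adjoint U = 1\<^sub>m d"

text \<open>
  The operator \<open>of_spectrum d U l\<close> has orthonormal eigenvectors given by the columns of \<open>U\<close>, with
  eigenvalues \<open>l 0, \<dots>, l (d - 1)\<close>.
\<close>

definition of_spectrum :: "nat \<Rightarrow> complex mat \<Rightarrow> (nat \<Rightarrow> real) \<Rightarrow> complex mat" where
  "of_spectrum d U l = U * mat_diag d (\<lambda>i. complex_of_real (l i)) * mat_adjoint U"

text \<open>
  Real powers of a positive semidefinite operator, through any diagonalization (the result does
  not depend on it, see \<open>mat_powr_of_spectrum\<close> below). Since \<open>0 powr s = 0\<close> for every \<open>s\<close>,
  including \<open>s = 0\<close>, powers are taken on the support only; in particular the power with
  exponent \<open>0\<close> is the projection onto the support.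
\<close>

definition mat_powr :: "nat \<Rightarrow> complex mat \<Rightarrow> real \<Rightarrow> complex mat" where
  "mat_powr d A s = (SOME B. \<exists>U l. unitary_op d U \<and> A = of_spectrum d U l \<and>
     B = of_spectrum d U (\<lambda>i. l i powr s))"

lemma of_spectrum_unique:
  assumes U: "unitary_op d U" and V: "unitary_op d V"
    and eq: "of_spectrum d U l = of_spectrum d V m"
  shows "of_spectrum d U (\<lambda>i. f (l i)) = of_spectrum d V (\<lambda>i. f (m i))"
proof -
  let ?D = "\<lambda>l. mat_diag d (\<lambda>i. complex_of_real (l i))"
  define U' where "U' = mat_adjoint U"
  define V' where "V' = mat_adjoint V"
  define W where "W = V' * U"
  have adj: "mat_adjoint A \<in> carrier_mat d d" if "A \<in> carrier_mat d d" for A :: "complex mat"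
    using that unfolding mat_adjoint_def by auto
  have c: "U \<in> carrier_mat d d" "V \<in> carrier_mat d d"
    using U V by (auto simp: unitary_op_def)
  have c': "U' \<in> carrier_mat d d" "V' \<in> carrier_mat d d"
    using adj c by (auto simp: U'_def V'_def)
  have W: "W \<in> carrier_mat d d" using c c' by (auto simp: W_def)
  have D: "?D x \<in> carrier_mat d d" for x by simp
  have u: "U' * U = 1\<^sub>m d" "U * U' = 1\<^sub>m d" and v: "V' * V = 1\<^sub>m d" "V * V' = 1\<^sub>m d"
    using U V by (auto simp: unitary_op_def U'_def V'_def)
  note assoc = assoc_mult_mat[of _ d d _ d _ d]
  have l: "V' * (U * ?D x * U') * U = W * ?D x" for x
  proof -
    have "V' * (U * ?D x * U') * U = V' * (U * ?D x) * (U' * U)"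
      using c c' D[of x] by (simp add: assoc mult_carrier_mat[of _ d d _ d])
    also have "\<dots> = W * ?D x"
      using c c' D[of x] u by (simp add: W_def assoc right_mult_one_mat[OF D])
    finally show ?thesis .
  qed
  have r: "V' * (V * ?D x * V') * U = ?D x * W" for x
  proof -
    have "V' * (V * ?D x * V') * U = (V' * V) * ?D x * (V' * U)"
      using c c' D[of x] by (simp add: assoc mult_carrier_mat[of _ d d _ d])
    then show ?thesis using v D[of x] by (simp add: W_def)
  qed
  have WD: "(W * ?D x) $$ (i,j) = W $$ (i,j) * complex_of_real (x j)"
    and DW: "(?D x * W) $$ (i,j) = complex_of_real (x i) * W $$ (i,j)"
    if "i < d" "j < d" for i j x
    using that by (simp_all only: mat_diag_mult_left[OF W] mat_diag_mult_right[OF W] index_mat prod.case)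
  have com: "W * ?D l = ?D m * W"
    using l[of l] r[of m] eq unfolding of_spectrum_def U'_def V'_def by simp
  have "W * ?D (\<lambda>i. f (l i)) = ?D (\<lambda>i. f (m i)) * W"
  proof (rule eq_matI)
    fix i j assume "i < dim_row (?D (\<lambda>i. f (m i)) * W)" "j < dim_col (?D (\<lambda>i. f (m i)) * W)"
    then have ij: "i < d" "j < d"
      using carrier_matD[OF mult_carrier_mat[OF D W]] by auto
    have "W $$ (i,j) * complex_of_real (l j) = complex_of_real (m i) * W $$ (i,j)"
      using arg_cong[OF com, of "\<lambda>M. M $$ (i,j)"] unfolding WD[OF ij] DW[OF ij] .
    then have "W $$ (i,j) = 0 \<or> l j = m i" by auto
    then show "(W * ?D (\<lambda>i. f (l i))) $$ (i,j) = (?D (\<lambda>i. f (m i)) * W) $$ (i,j)"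
      unfolding WD[OF ij] DW[OF ij] by auto
  next
    show "dim_row (W * ?D (\<lambda>i. f (l i))) = dim_row (?D (\<lambda>i. f (m i)) * W)"
      using carrier_matD[OF mult_carrier_mat[OF D W]] carrier_matD[OF mult_carrier_mat[OF W D]]
      by presburger
    show "dim_col (W * ?D (\<lambda>i. f (l i))) = dim_col (?D (\<lambda>i. f (m i)) * W)"
      using carrier_matD[OF mult_carrier_mat[OF D W]] carrier_matD[OF mult_carrier_mat[OF W D]]
      by presburger
  qed
  then have e: "V' * (U * ?D (\<lambda>i. f (l i)) * U') * U = V' * (V * ?D (\<lambda>i. f (m i)) * V') * U"
    by (simp only: l r)
  have cancel: "V * (V' * X * U) * U' = X" if X: "X \<in> carrier_mat d d" for X
  proof -
    have "V * (V' * X * U) * U' = (V * V') * X * (U * U')"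
      using c c' X by (simp add: assoc mult_carrier_mat[of _ d d _ d])
    also have "\<dots> = X"
      unfolding u v using X by simp
    finally show ?thesis .
  qed
  have car: "U * ?D x * U' \<in> carrier_mat d d" "V * ?D x * V' \<in> carrier_mat d d" for x
    using c c' by (auto intro!: mult_carrier_mat[OF mult_carrier_mat[OF _ D]])
  have "U * ?D (\<lambda>i. f (l i)) * U' = V * ?D (\<lambda>i. f (m i)) * V'"
    using cancel[OF car(1)[of "\<lambda>i. f (l i)"]] unfolding e cancel[OF car(2)] by (rule sym)
  then show ?thesis unfolding of_spectrum_def U'_def V'_def .
qed

lemma mat_powr_of_spectrum:
  assumes "unitary_op d U"
  shows "mat_powr d (of_spectrum d U l) s = of_spectrum d U (\<lambda>i. l i powr s)"
  unfolding mat_powr_def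
proof (rule some_equality)
  show "\<exists>V m. unitary_op d V \<and> of_spectrum d U l = of_spectrum d V m \<and>
      of_spectrum d U (\<lambda>i. l i powr s) = of_spectrum d V (\<lambda>i. m i powr s)"
    using assms by blast
next
  fix B
  assume "\<exists>V m. unitary_op d V \<and> of_spectrum d U l = of_spectrum d V m \<and>
      B = of_spectrum d V (\<lambda>i. m i powr s)"
  then show "B = of_spectrum d U (\<lambda>i. l i powr s)"
    using of_spectrum_unique[OF assms, of _ l _ "\<lambda>x. x powr s"] by metis
qed

text \<open>Kronecker product, the matrix of the tensor product in the lexicographic product basis.\<close>

definition kron :: "complex mat \<Rightarrow> complex mat \<Rightarrow> complex mat" where
  "kron A B = Matrix.mat (dim_row A * dim_row B) (dim_col A * dim_col B)
     (\<lambda>(i, j). A $$ (i div dim_row B, j div dim_col B) * B $$ (i mod dim_row B, j mod dim_col B))"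

fun tensor_pow :: "complex mat \<Rightarrow> nat \<Rightarrow> complex mat" where
  "tensor_pow A 0 = 1\<^sub>m 1"
| "tensor_pow A (Suc n) = kron A (tensor_pow A n)"

text \<open>The mixture \<open>\<Sum>\<^sub>i q\<^sub>i \<sigma>\<^sub>i\<^sup>\<otimes>\<^sup>n\<close> over \<open>i = 1, \<dots>, r\<close>, summed entrywise.\<close>

definition mix_tensor_pow ::
    "nat \<Rightarrow> nat \<Rightarrow> (nat \<Rightarrow> real) \<Rightarrow> (nat \<Rightarrow> complex mat) \<Rightarrow> nat \<Rightarrow> complex mat" where
  "mix_tensor_pow d r q \<sigma> n = Matrix.mat (d ^ n) (d ^ n)
     (\<lambda>(j, k). \<Sum>i = 1..r. complex_of_real (q i) * tensor_pow (\<sigma> i) n $$ (j, k))"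

text \<open>
  Optimal error for operators on a \<open>d\<close>-dimensional space; the infimum ranges over the tests
  \<open>0 \<le> E \<le> I\<close> and is attained by compactness. For positive semidefinite \<open>A\<close> and \<open>B\<close> all traces
  below are real.
\<close>

definition opt_error :: "nat \<Rightarrow> complex mat \<Rightarrow> complex mat \<Rightarrow> real" where
  "opt_error d A B = Inf {Re (op_trace (A * (1\<^sub>m d - E)) + op_trace (B * E)) | E.
     psd d E \<and> psd d (1\<^sub>m d - E)}"

definition elog :: "real \<Rightarrow> real \<Rightarrow> ereal" where
  "elog b x = (if x \<le> 0 then -\<infinity> else ereal (log b x))"

text \<open>
  Chernoff divergence, with values in the extended reals: it is \<open>\<infinity>\<close> exactly for orthogonal
  supports. The infimum is attained, because with the support convention for powers
  the trace is continuous in \<open>s\<close> on the whole closed interval.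
\<close>

definition chernoff_div :: "real \<Rightarrow> nat \<Rightarrow> complex mat \<Rightarrow> complex mat \<Rightarrow> ereal" where
  "chernoff_div b d A B =
     - elog b (INF s\<in>{0..1}. Re (op_trace (mat_powr d A s * mat_powr d B (1 - s))))"

end

theory Submission
  imports Defs
begin

text \<open>
  To states with spectral decompositions \<open>\<Sum> l\<^sub>i |u\<^sub>i\<rangle>\<langle>u\<^sub>i|\<close> and \<open>\<Sum> m\<^sub>j |v\<^sub>j\<rangle>\<langle>v\<^sub>j|\<close> Nussbaum and Szkola
  associate the classical error \<open>N = \<Sum> min l\<^sub>i m\<^sub>j |\<langle>u\<^sub>i, v\<^sub>j\<rangle>|\<^sup>2\<close>. Every test has error at least \<open>N / 2\<close>, so
  the first inequality follows from the classical Chernoff bound for \<open>N\<close>, proved by tilting, applied to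
  a single \<open>\<sigma>\<^sub>i\<close>.

  For the upper bound project each eigenvector \<open>v\<close> of each \<open>\<sigma>\<^sub>i\<^sup>\<otimes>\<^sup>n\<close> onto the span of those eigenvectors of
  \<open>\<rho>\<^sup>\<otimes>\<^sup>n\<close> that have a smaller eigenvalue, let \<open>S\<close> be \<open>t\<close> times the sum of the rank-one operators of these
  projections, and accept \<open>\<rho>\<close> with the test \<open>(1 + S)\<^sup>-\<^sup>1\<close>. Its errors are at most \<open>t \<Sum>\<^sub>i N\<^sub>i\<close> and
  \<open>N\<^sub>i + 1 / t\<close>; balancing \<open>t\<close> gives the square root, whence the factor \<open>1 / 2\<close> in the exponent. If \<open>\<rho>\<close> is
  pure, the test \<open>\<rho>\<^sup>\<otimes>\<^sup>n\<close> itself already attains the exponent.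
\<close>

section \<open>Unitary diagonalization\<close>

text \<open>The obstacle to the upper bound is that the \<sigma>_i need not commute with one
  another: good tests for the single pairs share no eigenbasis, and they cannot simply be
  intersected. The test is therefore built from vectors, because rank-one operators can be added.
  With S their sum, 1 - (1 + S)^-1 \<le> S, so \<rho> is charged only for its overlaps with the
  inserted vectors, and these charges add up over i. Conversely, an eigenvector of some \<sigma>_i
  is almost rejected if it is close to a multiple of an inserted vector, whatever else S contains.
  The rejection is incomplete because 1 + S is finite there, which is the cost 1 / t; a larger t
  lowers this cost but multiplies the charge to \<rho>. In the lower bound the mixture causes no
  difficulty: keeping one component loses only the constant factor q_i, which the rate does not see.

  The 1 / 2 in the bound N / 2 comes from splitting the amplitude of u against v into the parts seen
  by 1 - E and by E, and from |a + b|^2 \<le> 2 (|a|^2 + |b|^2). It is unrelated to the 1 / 2 in the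
  exponent.\<close>

lemma mat_adjoint_carrier [simp]:
  "A \<in> carrier_mat n m \<Longrightarrow> mat_adjoint A \<in> carrier_mat m n"
  unfolding mat_adjoint_def by auto

lemma dim_mat_adjoint [simp]:
  "dim_row (mat_adjoint A) = dim_col A" "dim_col (mat_adjoint A) = dim_row A"
  unfolding mat_adjoint_def by auto

lemma index_mat_adjoint [simp]:
  fixes A :: "complex mat"
  assumes "i < dim_col A" "j < dim_row A"
  shows "mat_adjoint A $$ (i, j) = cnj (A $$ (j, i))"
  using assms unfolding mat_adjoint_def by (simp add: mat_of_rows_def conjugate_complex_def)

lemma mat_adjoint_mult:
  fixes A :: "complex mat"
  assumes "A \<in> carrier_mat n m" "B \<in> carrier_mat m k"
  shows "mat_adjoint (A * B) = mat_adjoint B * mat_adjoint A"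
  using assms by (intro eq_matI) (auto simp: scalar_prod_def mult.commute)

lemma index_mat_adjoint_mult:
  fixes A :: "complex mat"
  assumes "A \<in> carrier_mat n m" "B \<in> carrier_mat n k" "i < m" "j < k"
  shows "(mat_adjoint A * B) $$ (i, j) = (\<Sum>x<n. cnj (A $$ (x, i)) * B $$ (x, j))"
  using assms by (simp add: scalar_prod_def lessThan_atLeast0)

lemma mat_adjoint_adjoint [simp]: "mat_adjoint (mat_adjoint A) = (A :: complex mat)"
  by (intro eq_matI) auto

lemma mat_adjoint_one [simp]: "mat_adjoint (1\<^sub>m n) = (1\<^sub>m n :: complex mat)"
  by (intro eq_matI) auto

lemma cscalar_prod_sum:
  fixes v w :: "complex vec"
  assumes "w \<in> carrier_vec n"
  shows "v \<bullet>c w = (\<Sum>i<n. v $ i * cnj (w $ i))"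
  using assms by (simp add: scalar_prod_def conjugate_complex_def lessThan_atLeast0)

lemma cscalar_prod_commute:
  fixes v w :: "complex vec"
  assumes "v \<in> carrier_vec n" "w \<in> carrier_vec n"
  shows "w \<bullet>c v = cnj (v \<bullet>c w)"
  using assms by (simp add: cscalar_prod_sum mult.commute)

lemma cscalar_prod_self:
  fixes v :: "complex vec"
  assumes "v \<in> carrier_vec n"
  shows "v \<bullet>c v = complex_of_real (\<Sum>i<n. (cmod (v $ i))\<^sup>2)"
  using assms by (simp only: cscalar_prod_sum of_real_sum complex_norm_square)

lemma cscalar_prod_mat_adjoint:
  fixes A :: "complex mat"
  assumes A: "A \<in> carrier_mat n m" and v: "v \<in> carrier_vec m" and w: "w \<in> carrier_vec n"
  shows "(A *\<^sub>v v) \<bullet>c w = v \<bullet>c (mat_adjoint A *\<^sub>v w)"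
proof -
  have "(A *\<^sub>v v) \<bullet>c w = (\<Sum>i<n. \<Sum>j<m. A $$ (i, j) * v $ j * cnj (w $ i))"
    using assms by (simp add: cscalar_prod_sum scalar_prod_def lessThan_atLeast0 sum_distrib_right)
  also have "\<dots> = (\<Sum>j<m. \<Sum>i<n. A $$ (i, j) * v $ j * cnj (w $ i))"
    by (rule sum.swap)
  also have "\<dots> = v \<bullet>c (mat_adjoint A *\<^sub>v w)"
    using assms mult_mat_vec_carrier[OF mat_adjoint_carrier[OF A] w]
    by (simp add: cscalar_prod_sum[of _ m] scalar_prod_def lessThan_atLeast0 sum_distrib_left
        mult.commute mult.left_commute)
  finally show ?thesis .
qed

lemma unitary_opD:
  assumes "unitary_op d U"
  shows "U \<in> carrier_mat d d" "mat_adjoint U * U = 1\<^sub>m d" "U * mat_adjoint U = 1\<^sub>m d"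
  using assms by (auto simp: unitary_op_def)

lemma unitary_op_mult:
  assumes "unitary_op d U" "unitary_op d V"
  shows "unitary_op d (U * V)"
proof -
  note U = unitary_opD[OF assms(1)] and V = unitary_opD[OF assms(2)]
  note assoc = assoc_mult_mat[of _ d d _ d _ d]
  have "mat_adjoint V * mat_adjoint U * (U * V) = mat_adjoint V * ((mat_adjoint U * U) * V)"
    using U(1) V(1) by (simp add: assoc mult_carrier_mat[of _ d d _ d])
  moreover have "U * V * (mat_adjoint V * mat_adjoint U) = U * ((V * mat_adjoint V) * mat_adjoint U)"
    using U(1) V(1) by (simp add: assoc mult_carrier_mat[of _ d d _ d])
  ultimately show ?thesis
    using U V left_mult_one_mat[OF V(1)] left_mult_one_mat[OF mat_adjoint_carrier[OF U(1)]]
    unfolding unitary_op_def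
    by (simp add: mat_adjoint_mult[of _ d d _ d] mult_carrier_mat[of _ d d _ d])
qed

lemma unitary_opI_left:
  assumes "U \<in> carrier_mat d d" "mat_adjoint U * U = 1\<^sub>m d"
  shows "unitary_op d U"
  using assms mat_mult_left_right_inverse[OF mat_adjoint_carrier[OF assms(1)] assms(1)]
  by (auto simp: unitary_op_def)

lemma parseval:
  assumes U: "unitary_op d U" and v: "v \<in> carrier_vec d"
  shows "v \<bullet>c v = complex_of_real (\<Sum>k<d. (cmod (v \<bullet>c col U k))\<^sup>2)"
proof -
  note u = unitary_opD[OF U]
  define w where "w = mat_adjoint U *\<^sub>v v"
  have w: "w \<in> carrier_vec d" using u v by (simp add: w_def mult_mat_vec_carrier[OF mat_adjoint_carrier])
  have "v = (U * mat_adjoint U) *\<^sub>v v" using u v by simp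
  also have "\<dots> = U *\<^sub>v w"
    using assoc_mult_mat_vec[OF u(1) mat_adjoint_carrier[OF u(1)] v] by (simp only: w_def)
  finally have vw: "v = U *\<^sub>v w" .
  have "v \<bullet>c v = w \<bullet>c w"
    using cscalar_prod_mat_adjoint[OF u(1) w v, folded w_def] vw by metis
  moreover have "cmod (w $ k) = cmod (v \<bullet>c col U k)" if "k < d" for k
  proof -
    have "w $ k = cnj (col U k \<bullet>c v)"
      using that u(1) v by (simp add: w_def scalar_prod_def conjugate_complex_def)
    also have "\<dots> = v \<bullet>c col U k"
      using cscalar_prod_commute[of "col U k" d v] u(1) v that by simp
    finally show ?thesis by simp
  qed
  ultimately show ?thesis using cscalar_prod_self[OF w] by simp
qed

section \<open>Calculus of operators given by an eigenbasis and eigenvalues\<close>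

lemma of_spectrum_carrier [simp]:
  assumes "unitary_op d U"
  shows "of_spectrum d U l \<in> carrier_mat d d"
  using unitary_opD(1)[OF assms] unfolding of_spectrum_def
  by (intro mult_carrier_mat[of _ d d _ d]) auto

lemma dim_of_spectrum [simp]:
  "dim_row (of_spectrum d U l) = dim_row U" "dim_col (of_spectrum d U l) = dim_row U"
  by (auto simp: of_spectrum_def)

lemma index_of_spectrum:
  assumes "unitary_op d U" "i < d" "j < d"
  shows "of_spectrum d U l $$ (i, j) = (\<Sum>k<d. U $$ (i, k) * complex_of_real (l k) * cnj (U $$ (j, k)))"
  using unitary_opD(1)[OF assms(1)] assms(2,3) unfolding of_spectrum_def
  by (simp add: mat_diag_mult_right[of _ d d] scalar_prod_def lessThan_atLeast0)

lemma mat_adjoint_of_spectrum: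
  assumes "unitary_op d U"
  shows "mat_adjoint (of_spectrum d U l) = of_spectrum d U l"
  using of_spectrum_carrier[OF assms, of l]
  by (intro eq_matI) (auto simp: index_of_spectrum[OF assms] mult.commute mult.left_commute)

lemma of_spectrum_col:
  assumes U: "unitary_op d U" and k: "k < d"
  shows "of_spectrum d U l *\<^sub>v col U k = complex_of_real (l k) \<cdot>\<^sub>v col U k"
proof -
  note u = unitary_opD[OF U]
  have "of_spectrum d U l *\<^sub>v col U k = col (of_spectrum d U l * U) k"
    using u(1) k of_spectrum_carrier[OF U, of l] by (metis col_mult2)
  also have "of_spectrum d U l * U = U * mat_diag d (\<lambda>i. complex_of_real (l i)) * (mat_adjoint U * U)"
    unfolding of_spectrum_def using u(1)
    by (simp add: assoc_mult_mat[of _ d d _ d _ d] mult_carrier_mat[of _ d d _ d])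
  also have "\<dots> = U * mat_diag d (\<lambda>i. complex_of_real (l i))"
    using u by (simp add: right_mult_one_mat[of _ d d] mult_carrier_mat[of _ d d _ d])
  also have "col \<dots> k = complex_of_real (l k) \<cdot>\<^sub>v col U k"
    using u(1) k by (intro eq_vecI) (auto simp: mat_diag_mult_right[of _ d d] mult.commute)
  finally show ?thesis .
qed

lemma of_spectrum_mult:
  assumes U: "unitary_op d U"
  shows "of_spectrum d U l * of_spectrum d U m = of_spectrum d U (\<lambda>i. l i * m i)"
proof -
  note u = unitary_opD[OF U]
  have "of_spectrum d U l * of_spectrum d U m = U * mat_diag d (\<lambda>i. complex_of_real (l i)) *
      ((mat_adjoint U * U) * (mat_diag d (\<lambda>i. complex_of_real (m i)) * mat_adjoint U))"
    unfolding of_spectrum_def using u(1)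
    by (simp add: assoc_mult_mat[of _ d d _ d _ d] mult_carrier_mat[of _ d d _ d])
  also have "\<dots> = U * mat_diag d (\<lambda>i. complex_of_real (l i)) *
      (mat_diag d (\<lambda>i. complex_of_real (m i)) * mat_adjoint U)"
    using u by (simp add: left_mult_one_mat[of _ d d] mult_carrier_mat[of _ d d _ d])
  also have "\<dots> = U * (mat_diag d (\<lambda>i. complex_of_real (l i)) *
      mat_diag d (\<lambda>i. complex_of_real (m i))) * mat_adjoint U"
    using u(1) by (simp only: assoc_mult_mat[of _ d d _ d _ d] mult_carrier_mat[of _ d d _ d]
        mat_adjoint_carrier mat_diag_dim)
  finally show ?thesis by (simp add: of_spectrum_def)
qed

lemma of_spectrum_cong:
  assumes "unitary_op d U" "\<And>k. k < d \<Longrightarrow> l k = m k"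
  shows "of_spectrum d U l = of_spectrum d U m"
  using unitary_opD(1)[OF assms(1)] assms
  by (intro eq_matI) (auto simp: index_of_spectrum)

lemma of_spectrum_add:
  assumes "unitary_op d U"
  shows "of_spectrum d U l + of_spectrum d U m = of_spectrum d U (\<lambda>i. l i + m i)"
  using unitary_opD(1)[OF assms]
  by (intro eq_matI) (auto simp: index_of_spectrum[OF assms] sum.distrib algebra_simps)

lemma of_spectrum_diff:
  assumes "unitary_op d U"
  shows "of_spectrum d U l - of_spectrum d U m = of_spectrum d U (\<lambda>i. l i - m i)"
  using unitary_opD(1)[OF assms]
  by (intro eq_matI) (auto simp: index_of_spectrum[OF assms] sum_subtractf algebra_simps)

lemma of_spectrum_one:
  assumes "unitary_op d U"
  shows "of_spectrum d U (\<lambda>_. 1) = 1\<^sub>m d"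
  using unitary_opD[OF assms] by (simp add: of_spectrum_def)

lemma of_spectrum_quadratic_form:
  assumes U: "unitary_op d U" and v: "v \<in> carrier_vec d"
  shows "(of_spectrum d U l *\<^sub>v v) \<bullet>c v = complex_of_real (\<Sum>k<d. l k * (cmod (v \<bullet>c col U k))\<^sup>2)"
proof -
  note u = unitary_opD[OF U]
  let ?D = "mat_diag d (\<lambda>i. complex_of_real (l i))"
  define w where "w = mat_adjoint U *\<^sub>v v"
  have w: "w \<in> carrier_vec d" using u v by (simp add: w_def mult_mat_vec_carrier[OF mat_adjoint_carrier])
  have "of_spectrum d U l *\<^sub>v v = U *\<^sub>v (?D *\<^sub>v w)"
    using u(1) v by (simp add: of_spectrum_def w_def assoc_mult_mat_vec[of _ d d _ d]
        mult_carrier_mat[of _ d d _ d] assoc_mult_mat[of _ d d _ d _ d])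
  then have "(of_spectrum d U l *\<^sub>v v) \<bullet>c v = (?D *\<^sub>v w) \<bullet>c w"
    using cscalar_prod_mat_adjoint[OF u(1) _ v, of "?D *\<^sub>v w"]
      mult_mat_vec_carrier[OF mat_diag_dim w] by (simp add: w_def[symmetric])
  also have "\<dots> = (\<Sum>k<d. (complex_of_real (l k) * w $ k) * cnj (w $ k))"
  proof -
    have "(?D *\<^sub>v w) $ k = complex_of_real (l k) * w $ k" if "k < d" for k
      using that w by (simp add: mat_diag_def scalar_prod_def if_distrib[of "\<lambda>x. x * _"] cong: if_cong)
    then show ?thesis using w by (simp add: cscalar_prod_sum)
  qed
  also have "\<dots> = complex_of_real (\<Sum>k<d. l k * (cmod (w $ k))\<^sup>2)"
    by (simp only: of_real_sum of_real_mult complex_norm_square mult.assoc)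
  also have "(\<Sum>k<d. l k * (cmod (w $ k))\<^sup>2) = (\<Sum>k<d. l k * (cmod (v \<bullet>c col U k))\<^sup>2)"
  proof (rule sum.cong[OF refl])
    fix k assume "k \<in> {..<d}"
    then have "w $ k = cnj (col U k \<bullet>c v)"
      using u(1) v by (simp add: w_def scalar_prod_def conjugate_complex_def)
    also have "\<dots> = v \<bullet>c col U k"
      using cscalar_prod_commute[of "col U k" d v] u(1) v \<open>k \<in> _\<close> by simp
    finally show "l k * (cmod (w $ k))\<^sup>2 = l k * (cmod (v \<bullet>c col U k))\<^sup>2" by simp
  qed
  finally show ?thesis .
qed

lemma psd_of_spectrum:
  assumes "unitary_op d U" "\<And>k. k < d \<Longrightarrow> 0 \<le> l k"
  shows "psd d (of_spectrum d U l)"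
  using assms unfolding psd_def
  by (auto simp: mat_adjoint_of_spectrum of_spectrum_quadratic_form less_eq_complex_def
      intro!: sum_nonneg)

text \<open>Evaluates the trace in the eigenbasis of the state, so that bounds on error
  probabilities become bounds on quadratic forms of the test at single eigenvectors.\<close>

lemma op_trace_of_spectrum_mult:
  assumes U: "unitary_op d U" and M: "M \<in> carrier_mat d d"
  shows "op_trace (of_spectrum d U l * M) =
    (\<Sum>k<d. complex_of_real (l k) * ((M *\<^sub>v col U k) \<bullet>c col U k))"
proof -
  note u = unitary_opD[OF U]
  have "op_trace (of_spectrum d U l * M) = (\<Sum>i<d. \<Sum>j<d. \<Sum>k<d.
      U $$ (i, k) * complex_of_real (l k) * cnj (U $$ (j, k)) * M $$ (j, i))"
    using M u(1)
    by (simp add: op_trace_def scalar_prod_def lessThan_atLeast0 index_of_spectrum[OF U]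
        sum_distrib_right)
  also have "\<dots> = (\<Sum>i<d. \<Sum>k<d. \<Sum>j<d.
      U $$ (i, k) * complex_of_real (l k) * cnj (U $$ (j, k)) * M $$ (j, i))"
    by (intro sum.cong refl sum.swap)
  also have "\<dots> = (\<Sum>k<d. \<Sum>i<d. \<Sum>j<d.
      U $$ (i, k) * complex_of_real (l k) * cnj (U $$ (j, k)) * M $$ (j, i))"
    by (rule sum.swap)
  also have "\<dots> = (\<Sum>k<d. \<Sum>j<d. \<Sum>i<d.
      U $$ (i, k) * complex_of_real (l k) * cnj (U $$ (j, k)) * M $$ (j, i))"
    by (intro sum.cong refl sum.swap)
  also have "\<dots> = (\<Sum>k<d. complex_of_real (l k) * ((M *\<^sub>v col U k) \<bullet>c col U k))"
    using M u(1) by (simp add: cscalar_prod_sum[of _ d] scalar_prod_def lessThan_atLeast0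
        sum_distrib_left sum_distrib_right mult.commute mult.left_commute)
  finally show ?thesis .
qed

text \<open>The transition probabilities between two orthonormal bases. They are read off a matrix
  entry rather than an inner product because \<open>kron\<close> multiplies entries, which gives
  \<open>overlap_tensor_pow\<close>.\<close>

definition overlap :: "complex mat \<Rightarrow> complex mat \<Rightarrow> nat \<Rightarrow> nat \<Rightarrow> real" where
  "overlap U V i j = (cmod ((mat_adjoint U * V) $$ (i, j)))\<^sup>2"

lemma overlap_nonneg [simp]: "0 \<le> overlap U V i j"
  by (simp add: overlap_def)

lemma overlap_cscalar_prod:
  assumes "U \<in> carrier_mat d d" "V \<in> carrier_mat d d" "i < d" "j < d"
  shows "(cmod (col V j \<bullet>c col U i))\<^sup>2 = overlap U V i j"
    and "(cmod (col U i \<bullet>c col V j))\<^sup>2 = overlap U V i j"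
proof -
  have "(mat_adjoint U * V) $$ (i, j) = col V j \<bullet>c col U i"
    using assms by (simp add: scalar_prod_def conjugate_complex_def mult.commute)
  moreover have "cmod (col U i \<bullet>c col V j) = cmod (col V j \<bullet>c col U i)"
    using cscalar_prod_commute[of "col V j" d "col U i"] assms by simp
  ultimately show "(cmod (col V j \<bullet>c col U i))\<^sup>2 = overlap U V i j"
    and "(cmod (col U i \<bullet>c col V j))\<^sup>2 = overlap U V i j"
    by (simp_all add: overlap_def)
qed

lemma overlap_sum:
  assumes U: "unitary_op d U" and V: "unitary_op d V" and j: "j < d"
  shows "(\<Sum>i<d. overlap U V i j) = 1"
proof -
  note u = unitary_opD[OF U] and v = unitary_opD[OF V]
  have "col V j \<bullet>c col V j = (mat_adjoint V * V) $$ (j, j)"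
    using v(1) j by (simp add: scalar_prod_def conjugate_complex_def mult.commute)
  then have "col V j \<bullet>c col V j = 1" using v j by simp
  then show ?thesis
    using parseval[OF U, of "col V j"] u v j
    by (simp add: overlap_cscalar_prod flip: of_real_sum)
qed

text \<open>Makes the Chernoff trace classical: applied to powers of the eigenvalues it yields
  \<open>chernoff_sum\<close>, where the eigenbases survive only through
  \<open>overlap\<close>.\<close>

lemma op_trace_of_spectrum_of_spectrum:
  assumes U: "unitary_op d U" and V: "unitary_op d V"
  shows "op_trace (of_spectrum d U l * of_spectrum d V m) =
    complex_of_real (\<Sum>i<d. \<Sum>j<d. l i * m j * overlap U V i j)"
  using unitary_opD(1)[OF U] unitary_opD(1)[OF V]
  by (simp add: op_trace_of_spectrum_mult[OF U of_spectrum_carrier[OF V]] of_spectrum_quadratic_form[OF V]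
      overlap_cscalar_prod(2)[of U d V] sum_distrib_left mult.assoc)

lemma op_trace_of_spectrum:
  assumes U: "unitary_op d U"
  shows "op_trace (of_spectrum d U l) = complex_of_real (\<Sum>i<d. l i)"
proof -
  note u = unitary_opD[OF U]
  have "col U i \<bullet>c col U i = 1" if "i < d" for i
  proof -
    have "col U i \<bullet>c col U i = (mat_adjoint U * U) $$ (i, i)"
      using u(1) that by (simp add: scalar_prod_def conjugate_complex_def mult.commute)
    then show ?thesis using u that by simp
  qed
  then show ?thesis
    using op_trace_of_spectrum_mult[OF U, of "1\<^sub>m d" l] u of_spectrum_carrier[OF U, of l]
    by (simp add: right_mult_one_mat[of _ d d])
qed

section \<open>The spectral theorem for Hermitian matrices\<close>

lemma unitary_with_first_column:
  fixes v :: "complex vec"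
  assumes v: "v \<in> carrier_vec (Suc n)" and v0: "v \<noteq> 0\<^sub>v (Suc n)"
  obtains W c where "unitary_op (Suc n) W" "col W 0 = c \<cdot>\<^sub>v v"
proof -
  let ?n = "Suc n"
  define b where "b = basis_completion v"
  define ws where "ws = gram_schmidt ?n b"
  interpret cof_vec_space ?n "TYPE(complex)" .
  from basis_completion[OF v v0, folded b_def]
  have dist_b: "distinct b" and indep: "\<not> lin_dep (set b)" and b: "set b \<subseteq> carrier_vec ?n"
    and hdb: "hd b = v" and len_b: "length b = ?n" by auto
  from hdb len_b obtain vs where bv: "b = v # vs" by (cases b, auto)
  from gram_schmidt_result[OF b dist_b indep refl, folded ws_def]
  have ws: "set ws \<subseteq> carrier_vec ?n" "corthogonal ws" "length ws = ?n"
    by (auto simp: len_b)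
  from gram_schmidt_hd[OF v, of vs, folded bv] have "hd ws = v" unfolding ws_def .
  then have ws0: "ws ! 0 = v" using ws(3) by (cases ws) auto
  have wsc: "ws ! j \<in> carrier_vec ?n" if "j < ?n" for j using ws that by auto
  define N where "N j = sqrt (\<Sum>i<?n. (cmod (ws ! j $ i))\<^sup>2)" for j
  have N2: "ws ! j \<bullet>c ws ! j = complex_of_real (N j) * complex_of_real (N j)" if "j < ?n" for j
    using cscalar_prod_self[OF wsc[OF that]]
    by (simp add: N_def sum_nonneg flip: of_real_mult)
  have N0: "N j \<noteq> 0" if "j < ?n" for j
    using corthogonalD[OF ws(2), of j j] N2[OF that] that ws(3) by auto
  \<comment> \<open>Gram-Schmidt gives orthogonal columns of arbitrary length. After normalization
    the first column is only a multiple of \<open>v\<close>, which is still an eigenvector when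
    \<open>v\<close> is one.\<close>
  define W where "W = mat ?n ?n (\<lambda>(i, j). ws ! j $ i / complex_of_real (N j))"
  have W: "W \<in> carrier_mat ?n ?n" by (simp add: W_def)
  have "mat_adjoint W * W = 1\<^sub>m ?n"
  proof (rule eq_matI)
    fix i j assume "i < dim_row (1\<^sub>m ?n :: complex mat)" "j < dim_col (1\<^sub>m ?n :: complex mat)"
    then have ij: "i < ?n" "j < ?n" by auto
    have "(mat_adjoint W * W) $$ (i, j) = (\<Sum>k<?n. cnj (W $$ (k, i)) * W $$ (k, j))"
      using W ij by (simp add: scalar_prod_def lessThan_atLeast0 del: sum.op_ivl_Suc)
    also have "\<dots> = (\<Sum>k<?n. ws ! j $ k * cnj (ws ! i $ k)) / (complex_of_real (N i) * complex_of_real (N j))"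
      unfolding sum_divide_distrib using ij by (intro sum.cong) (auto simp: W_def mult.commute)
    also have "\<dots> = (ws ! j \<bullet>c ws ! i) / (complex_of_real (N i) * complex_of_real (N j))"
      using cscalar_prod_sum[OF wsc[OF ij(1)]] by simp
    also have "\<dots> = 1\<^sub>m ?n $$ (i, j)"
      using corthogonalD[OF ws(2), of j i] N2[OF ij(1)] N0[OF ij(1)] ij ws(3) by auto
    finally show "(mat_adjoint W * W) $$ (i, j) = 1\<^sub>m ?n $$ (i, j)" .
  qed (use W in auto)
  then have "unitary_op ?n W" using W by (intro unitary_opI_left)
  moreover have "col W 0 = (1 / complex_of_real (N 0)) \<cdot>\<^sub>v v"
    using v ws0 by (intro eq_vecI) (auto simp: W_def)
  ultimately show ?thesis using that by blast
qed

lemma of_spectrum_conjugate: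
  assumes W: "unitary_op d W" and U: "unitary_op d U"
  shows "W * of_spectrum d U l * mat_adjoint W = of_spectrum d (W * U) l"
  using unitary_opD(1)[OF W] unitary_opD(1)[OF U]
  by (simp add: of_spectrum_def mat_adjoint_mult[of _ d d _ d] assoc_mult_mat[of _ d d _ d _ d]
      mult_carrier_mat[of _ d d _ d])

text \<open>Deflation: in an orthonormal basis starting with an eigenvector the first column
  vanishes below the corner. Hermitian symmetry clears the first row as well, so the remaining block
  is Hermitian and the induction applies to it.\<close>

theorem hermitian_diagonalizable:
  assumes "A \<in> carrier_mat n n" "mat_adjoint A = A"
  shows "\<exists>U l. unitary_op n U \<and> A = of_spectrum n U l"
  using assms
proof (induction n arbitrary: A)
  case 0
  have "unitary_op 0 (1\<^sub>m 0)" by (simp add: unitary_op_def)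
  moreover have "A = of_spectrum 0 (1\<^sub>m 0) (\<lambda>_. 0)"
    using 0 by (intro eq_matI) auto
  ultimately show ?case by blast
next
  case (Suc n)
  let ?n = "Suc n"
  have A: "A \<in> carrier_mat ?n ?n" and herm: "mat_adjoint A = A" using Suc by auto
  have "degree (char_poly A) = ?n" using degree_monic_char_poly[OF A] by simp
  then have "\<not> constant (poly (char_poly A))" by (simp add: constant_degree)
  then obtain e where "poly (char_poly A) e = 0"
    using fundamental_theorem_of_algebra by blast
  then have "eigenvalue A e" using eigenvalue_root_char_poly[OF A] by simp
  then obtain v where v: "v \<in> carrier_vec ?n" "v \<noteq> 0\<^sub>v ?n" and Av: "A *\<^sub>v v = e \<cdot>\<^sub>v v"
    using A by (auto simp: eigenvalue_def eigenvector_def)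
  obtain W c where W: "unitary_op ?n W" and W0: "col W 0 = c \<cdot>\<^sub>v v"
    using unitary_with_first_column[OF v] .
  note w = unitary_opD[OF W]
  define A' where "A' = mat_adjoint W * A * W"
  have A': "A' \<in> carrier_mat ?n ?n"
    using A w(1) unfolding A'_def by (intro mult_carrier_mat[of _ ?n ?n _ ?n] mat_adjoint_carrier)
  have "mat_adjoint A' = mat_adjoint W * (A * W)"
    unfolding A'_def using A w(1) herm
    by (simp add: mat_adjoint_mult[of _ ?n ?n _ ?n] mult_carrier_mat[of _ ?n ?n _ ?n])
  then have herm': "mat_adjoint A' = A'"
    unfolding A'_def using A w(1) by (simp add: assoc_mult_mat[of _ ?n ?n _ ?n _ ?n])
  have sym: "A' $$ (j, i) = cnj (A' $$ (i, j))" if "i < ?n" "j < ?n" for i j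
    using arg_cong[OF herm', of "\<lambda>M. M $$ (j, i)"] that A' by simp
  have AW: "A = W * A' * mat_adjoint W"
  proof -
    have "W * A' * mat_adjoint W = (W * mat_adjoint W) * A * (W * mat_adjoint W)"
      unfolding A'_def using A w(1)
      by (simp add: assoc_mult_mat[of _ ?n ?n _ ?n _ ?n] mult_carrier_mat[of _ ?n ?n _ ?n])
    then show ?thesis using w A by simp
  qed
  have "A *\<^sub>v col W 0 = e \<cdot>\<^sub>v col W 0"
    using A v Av W0 by (simp add: mult_mat_vec smult_smult_assoc mult.commute)
  then have "col (A * W) 0 = e \<cdot>\<^sub>v col W 0"
    using A w(1) by (metis col_mult2 zero_less_Suc)
  then have AW0: "(A * W) $$ (k, 0) = e * W $$ (k, 0)" if "k < ?n" for k
  proof -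
    have "(A * W) $$ (k, 0) = col (A * W) 0 $ k" using that A w(1) by simp
    also have "\<dots> = e * W $$ (k, 0)"
      unfolding \<open>col (A * W) 0 = e \<cdot>\<^sub>v col W 0\<close> using that w(1) by simp
    finally show ?thesis .
  qed
  have A'0: "A' $$ (i, 0) = (if i = 0 then e else 0)" if "i < ?n" for i
  proof -
    have "A' $$ (i, 0) = (mat_adjoint W * (A * W)) $$ (i, 0)"
      unfolding A'_def using A w(1) by (simp add: assoc_mult_mat[of _ ?n ?n _ ?n _ ?n])
    also have "\<dots> = (\<Sum>k<?n. cnj (W $$ (k, i)) * (A * W) $$ (k, 0))"
      using that A w(1) by (intro index_mat_adjoint_mult[of _ _ ?n _ ?n]) auto
    also have "\<dots> = e * (\<Sum>k<?n. cnj (W $$ (k, i)) * W $$ (k, 0))"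
      by (simp add: AW0 sum_distrib_left mult.left_commute del: sum.lessThan_Suc)
    also have "(\<Sum>k<?n. cnj (W $$ (k, i)) * W $$ (k, 0)) = (mat_adjoint W * W) $$ (i, 0)"
      using that w(1) by (intro index_mat_adjoint_mult[symmetric, of _ _ ?n _ ?n]) auto
    finally show ?thesis using w that by simp
  qed
  define A3 where "A3 = mat n n (\<lambda>(i, j). A' $$ (Suc i, Suc j))"
  have A3: "A3 \<in> carrier_mat n n" by (simp add: A3_def)
  have "mat_adjoint A3 = A3"
    by (intro eq_matI) (auto simp: A3_def sym[symmetric])
  then obtain V m where V: "unitary_op n V" and A3V: "A3 = of_spectrum n V m"
    using Suc.IH[OF A3] by blast
  note v' = unitary_opD[OF V]
  define U where "U = mat ?n ?n (\<lambda>(i, j). case (i, j) of (Suc i, Suc j) \<Rightarrow> V $$ (i, j) |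
    (0, 0) \<Rightarrow> 1 | _ \<Rightarrow> 0)"
  have U: "U \<in> carrier_mat ?n ?n" by (simp add: U_def)
  have U_simps: "U $$ (0, 0) = 1" "\<And>i. i < n \<Longrightarrow> U $$ (Suc i, 0) = 0" "\<And>i. i < n \<Longrightarrow> U $$ (0, Suc i) = 0"
    "\<And>i j. i < n \<Longrightarrow> j < n \<Longrightarrow> U $$ (Suc i, Suc j) = V $$ (i, j)"
    by (auto simp: U_def)
  have "mat_adjoint U * U = 1\<^sub>m ?n"
  proof (rule eq_matI)
    fix i j assume "i < dim_row (1\<^sub>m ?n :: complex mat)" "j < dim_col (1\<^sub>m ?n :: complex mat)"
    then have ij: "i < ?n" "j < ?n" by auto
    have VV: "(\<Sum>k<n. cnj (V $$ (k, i)) * V $$ (k, j)) = (if i = j then 1 else 0)" if "i < n" "j < n" for i j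
      using arg_cong[OF v'(2), of "\<lambda>M. M $$ (i, j)"] v'(1) that
      by (simp add: scalar_prod_def lessThan_atLeast0)
    have "(mat_adjoint U * U) $$ (i, j) = (\<Sum>k<?n. cnj (U $$ (k, i)) * U $$ (k, j))"
      using U ij by (simp add: scalar_prod_def lessThan_atLeast0 del: sum.op_ivl_Suc)
    also have "\<dots> = 1\<^sub>m ?n $$ (i, j)"
      unfolding sum.lessThan_Suc_shift using ij
      by (cases i; cases j) (simp_all add: U_simps VV del: sum.lessThan_Suc)
    finally show "(mat_adjoint U * U) $$ (i, j) = 1\<^sub>m ?n $$ (i, j)" .
  qed (use U in auto)
  then have U_unitary: "unitary_op ?n U" using U by (intro unitary_opI_left)
  have e_real: "complex_of_real (Re e) = e"
    using A'0[of 0] sym[of 0 0] by (auto simp: complex_eq_iff)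
  define l where "l = case_nat (Re e) m"
  have "A' = of_spectrum ?n U l"
  proof (rule eq_matI)
    fix i j assume "i < dim_row (of_spectrum ?n U l)" "j < dim_col (of_spectrum ?n U l)"
    then have ij: "i < ?n" "j < ?n" using U by auto
    have V3: "A' $$ (Suc i, Suc j) = (\<Sum>k<n. V $$ (i, k) * complex_of_real (m k) * cnj (V $$ (j, k)))"
      if "i < n" "j < n" for i j
      using index_of_spectrum[OF V that, of m] that by (simp add: A3V[symmetric]) (simp add: A3_def)
    show "A' $$ (i, j) = of_spectrum ?n U l $$ (i, j)"
      unfolding index_of_spectrum[OF U_unitary ij] sum.lessThan_Suc_shift using ij
      by (cases i; cases j) (simp_all add: U_simps l_def A'0 e_real sym[of "Suc _" 0] V3 del: sum.lessThan_Suc)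
  qed (use A' U in auto)
  then have "A = of_spectrum ?n (W * U) l"
    using AW of_spectrum_conjugate[OF W U_unitary] by simp
  then show ?case using unitary_op_mult[OF W U_unitary] by blast
qed

lemma psd_spectral:
  assumes "psd d A"
  obtains U l where "unitary_op d U" "A = of_spectrum d U l" "\<And>k. 0 \<le> l k"
proof -
  have A: "A \<in> carrier_mat d d" "mat_adjoint A = A"
    and pos: "\<And>v. v \<in> carrier_vec d \<Longrightarrow> 0 \<le> (A *\<^sub>v v) \<bullet>c v"
    using assms by (auto simp: psd_def)
  obtain U l where U: "unitary_op d U" and l: "A = of_spectrum d U l"
    using hermitian_diagonalizable[OF A] by blast
  note u = unitary_opD[OF U]
  have "0 \<le> l k" if "k < d" for k
  proof -
    have "col U k \<bullet>c col U k = (mat_adjoint U * U) $$ (k, k)"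
      using u(1) that by (simp add: scalar_prod_def conjugate_complex_def mult.commute)
    then have "col U k \<bullet>c col U k = 1" using u that by simp
    then have "(A *\<^sub>v col U k) \<bullet>c col U k = complex_of_real (l k)"
      using of_spectrum_col[OF U that, of l] u(1) that by (simp add: l)
    then show ?thesis using pos[of "col U k"] u(1) that by (simp add: less_eq_complex_def)
  qed
  \<comment> \<open>The values of \<open>l\<close> at indices from \<open>d\<close> on are
    arbitrary. Truncating at 0 makes nonnegativity hold at every index, so later hypotheses need no
    range condition.\<close>
  then have "A = of_spectrum d U (\<lambda>k. max 0 (l k))"
    unfolding l by (intro of_spectrum_cong[OF U]) auto
  then show ?thesis using that[OF U] by simp
qed

section \<open>Single-shot error bounds\<close>

lemma mult_one_minus_mat_vec:
  fixes E :: "complex mat"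
  assumes "E \<in> carrier_mat d d" "v \<in> carrier_vec d"
  shows "(1\<^sub>m d - E) *\<^sub>v v = v - E *\<^sub>v v"
  using assms by (simp add: minus_mult_distrib_mat_vec[of _ d d])

lemma psd_quadratic_form:
  assumes "psd d E" "v \<in> carrier_vec d"
  shows "(E *\<^sub>v v) \<bullet>c v = complex_of_real (Re ((E *\<^sub>v v) \<bullet>c v))"
    and "0 \<le> Re ((E *\<^sub>v v) \<bullet>c v)"
  using assms by (auto simp: psd_def less_eq_complex_def complex_eq_iff)

lemma op_trace_psd_of_spectrum_nonneg:
  assumes U: "unitary_op d U" and l: "\<And>k. 0 \<le> l k" and E: "psd d E"
  shows "0 \<le> Re (op_trace (of_spectrum d U l * E))"
proof -
  have c: "E \<in> carrier_mat d d" using E by (simp add: psd_def)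
  show ?thesis
    unfolding op_trace_of_spectrum_mult[OF U c]
    using psd_quadratic_form(2)[OF E] l unitary_opD(1)[OF U]
    by (auto intro!: sum_nonneg simp: Re_complex_of_real)
qed

text \<open>\<open>E\<^sup>2 \<le> E\<close> for a test \<open>E\<close>, because \<open>E - E\<^sup>2 = E (1 - E) E + (1 - E) E (1 - E)\<close>.\<close>

lemma test_square_le:
  assumes E: "psd d E" and E': "psd d (1\<^sub>m d - E)" and v: "v \<in> carrier_vec d"
  shows "Re ((E *\<^sub>v v) \<bullet>c (E *\<^sub>v v)) \<le> Re ((E *\<^sub>v v) \<bullet>c v)"
proof -
  have c: "E \<in> carrier_mat d d" and h: "mat_adjoint E = E" using E by (auto simp: psd_def)
  define w where "w = E *\<^sub>v v"
  define x where "x = E *\<^sub>v w"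
  have w: "w \<in> carrier_vec d" and x: "x \<in> carrier_vec d" using c v by (auto simp: w_def x_def)
  have "0 \<le> Re ((w - x) \<bullet>c w)"
    using psd_quadratic_form(2)[OF E' w] by (simp add: mult_one_minus_mat_vec[OF c w] x_def)
  moreover have "0 \<le> Re ((w - x) \<bullet>c (v - w))"
    using psd_quadratic_form(2)[OF E, of "v - w"] v w c
    by (simp add: x_def mult_minus_distrib_mat_vec[of _ d d] w_def)
  moreover have "x \<bullet>c v = w \<bullet>c w"
    using cscalar_prod_mat_adjoint[OF c w v] by (simp add: h x_def w_def[symmetric])
  moreover have "(w - x) \<bullet>c w = w \<bullet>c w - x \<bullet>c w"
    using w x by (simp add: minus_scalar_prod_distrib[of _ d])
  moreover have "(w - x) \<bullet>c (v - w) = w \<bullet>c v - w \<bullet>c w - x \<bullet>c v + x \<bullet>c w"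
    using w x v by (simp add: cscalar_prod_sum[of _ d] algebra_simps sum.distrib sum_subtractf)
  ultimately show ?thesis by (simp add: w_def[symmetric])
qed

text \<open>The least error of a classical decision between the weights
  \<open>l i * overlap U V i j\<close> and \<open>m j * overlap U V i j\<close> on pairs of indices;
  the common factor is taken out of the minimum.\<close>

definition classical_error ::
  "nat \<Rightarrow> complex mat \<Rightarrow> (nat \<Rightarrow> real) \<Rightarrow> complex mat \<Rightarrow> (nat \<Rightarrow> real) \<Rightarrow> real" where
  "classical_error d U l V m = (\<Sum>i<d. \<Sum>j<d. min (l i) (m j) * overlap U V i j)"

text \<open>The inner product of \<open>col U i\<close> and \<open>col V j\<close> is
  \<open>f i j + g i j\<close>, the contributions of \<open>1 - E\<close> and \<open>E\<close>.
  Parseval and \<open>test_square_le\<close> bound the weighted sums of their squared moduli by the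
  two errors. Each weight is at least the minimum of the eigenvalues, so
  \<open>|f + g|^2 \<le> 2 (|f|^2 + |g|^2)\<close> finishes the proof.\<close>

lemma test_error_ge:
  assumes U: "unitary_op d U" and V: "unitary_op d V"
    and l: "\<And>k. 0 \<le> l k" and m: "\<And>k. 0 \<le> m k"
    and E: "psd d E" and E': "psd d (1\<^sub>m d - E)"
  shows "classical_error d U l V m / 2 \<le>
    Re (op_trace (of_spectrum d U l * (1\<^sub>m d - E))) + Re (op_trace (of_spectrum d V m * E))"
proof -
  note u = unitary_opD[OF U] and v = unitary_opD[OF V]
  have c: "E \<in> carrier_mat d d" and h: "mat_adjoint E = E" using E by (auto simp: psd_def)
  have c': "1\<^sub>m d - E \<in> carrier_mat d d" using c by (rule minus_carrier_mat)
  have one: "1\<^sub>m d - (1\<^sub>m d - E) = E" using c by (intro eq_matI) auto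
  define f where "f i j = (col U i - E *\<^sub>v col U i) \<bullet>c col V j" for i j
  define g where "g i j = (E *\<^sub>v col U i) \<bullet>c col V j" for i j
  have uc: "col U i \<in> carrier_vec d" "E *\<^sub>v col U i \<in> carrier_vec d"
    "col V i \<in> carrier_vec d" "E *\<^sub>v col V i \<in> carrier_vec d" if "i < d" for i
    using u(1) v(1) c that by auto
  have 1: "(\<Sum>i<d. l i * (\<Sum>j<d. (cmod (f i j))\<^sup>2)) \<le> Re (op_trace (of_spectrum d U l * (1\<^sub>m d - E)))"
  proof -
    have "(\<Sum>j<d. (cmod (f i j))\<^sup>2) \<le> Re (((1\<^sub>m d - E) *\<^sub>v col U i) \<bullet>c col U i)" if i: "i < d" for i
    proof -
      have "complex_of_real (\<Sum>j<d. (cmod (f i j))\<^sup>2) =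
          ((1\<^sub>m d - E) *\<^sub>v col U i) \<bullet>c ((1\<^sub>m d - E) *\<^sub>v col U i)"
        using parseval[OF V, of "(1\<^sub>m d - E) *\<^sub>v col U i"] uc[OF i]
        by (simp add: mult_one_minus_mat_vec[OF c uc(1)[OF i]] f_def)
      then show ?thesis
        using test_square_le[OF E' _ uc(1)[OF i]] E by (metis Re_complex_of_real one)
    qed
    then show ?thesis
      unfolding op_trace_of_spectrum_mult[OF U c']
      by (auto intro!: sum_mono mult_left_mono l)
  qed
  have 2: "(\<Sum>j<d. m j * (\<Sum>i<d. (cmod (g i j))\<^sup>2)) \<le> Re (op_trace (of_spectrum d V m * E))"
  proof -
    have "(\<Sum>i<d. (cmod (g i j))\<^sup>2) \<le> Re ((E *\<^sub>v col V j) \<bullet>c col V j)" if j: "j < d" for j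
    proof -
      \<comment> \<open>Moving the Hermitian \<open>E\<close> to the other vector turns the sum over
        \<open>i\<close> into a Parseval sum for \<open>E *\<^sub>v col V j\<close> in the basis
        \<open>U\<close>.\<close>
      have "cmod (g i j) = cmod ((E *\<^sub>v col V j) \<bullet>c col U i)" if i: "i < d" for i
        using cscalar_prod_mat_adjoint[OF c uc(1)[OF i] uc(3)[OF j]]
          cscalar_prod_commute[OF uc(1)[OF i] uc(4)[OF j]] by (simp add: h g_def)
      then have "complex_of_real (\<Sum>i<d. (cmod (g i j))\<^sup>2) = (E *\<^sub>v col V j) \<bullet>c (E *\<^sub>v col V j)"
        using parseval[OF U uc(4)[OF j]] by simp
      then show ?thesis
        using test_square_le[OF E E' uc(3)[OF j]] by (metis Re_complex_of_real)
    qed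
    then show ?thesis
      unfolding op_trace_of_spectrum_mult[OF V c]
      by (auto intro!: sum_mono mult_left_mono m)
  qed
  have "min (l i) (m j) * overlap U V i j / 2 \<le> l i * (cmod (f i j))\<^sup>2 + m j * (cmod (g i j))\<^sup>2"
    if ij: "i < d" "j < d" for i j
  proof -
    let ?a = "cmod (f i j)" and ?b = "cmod (g i j)"
    have "f i j = col U i \<bullet>c col V j - g i j"
      unfolding f_def g_def using uc[OF ij(1)] uc[OF ij(2)]
      by (simp add: minus_scalar_prod_distrib[of _ d])
    then have "f i j + g i j = col U i \<bullet>c col V j" by simp
    then have "overlap U V i j = (cmod (f i j + g i j))\<^sup>2"
      using overlap_cscalar_prod(2)[OF u(1) v(1) ij] by simp
    also have "\<dots> \<le> (?a + ?b)\<^sup>2" by (intro power_mono norm_triangle_ineq) auto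
    also have "\<dots> \<le> 2 * (?a\<^sup>2 + ?b\<^sup>2)"
      using zero_le_power2[of "?a - ?b"] by (simp add: power2_eq_square algebra_simps)
    finally have "min (l i) (m j) * overlap U V i j \<le> min (l i) (m j) * (2 * (?a\<^sup>2 + ?b\<^sup>2))"
      using l m by (intro mult_left_mono) auto
    moreover have "min (l i) (m j) * ?a\<^sup>2 \<le> l i * ?a\<^sup>2" "min (l i) (m j) * ?b\<^sup>2 \<le> m j * ?b\<^sup>2"
      by (intro mult_right_mono; simp)+
    ultimately show ?thesis by (simp add: algebra_simps)
  qed
  then have "classical_error d U l V m / 2 \<le> (\<Sum>i<d. \<Sum>j<d. l i * (cmod (f i j))\<^sup>2 + m j * (cmod (g i j))\<^sup>2)"
    unfolding classical_error_def sum_divide_distrib by (intro sum_mono) auto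
  also have "\<dots> = (\<Sum>i<d. l i * (\<Sum>j<d. (cmod (f i j))\<^sup>2)) + (\<Sum>i<d. \<Sum>j<d. m j * (cmod (g i j))\<^sup>2)"
    by (simp add: sum.distrib sum_distrib_left)
  also have "(\<Sum>i<d. \<Sum>j<d. m j * (cmod (g i j))\<^sup>2) = (\<Sum>j<d. m j * (\<Sum>i<d. (cmod (g i j))\<^sup>2))"
    unfolding sum_distrib_left by (rule sum.swap)
  finally show ?thesis using 1 2 by simp
qed

text \<open>The witness is \<open>E = (1 + S)\<^sup>-\<^sup>1\<close>, where \<open>S\<close> is the sum of the operators \<open>|z k\<rangle>\<langle>z k|\<close>.\<close>

lemma inverse_test_exists:
  assumes I: "finite I" and z: "\<And>k. k \<in> I \<Longrightarrow> z k \<in> carrier_vec d"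
  obtains E where "psd d E" "psd d (1\<^sub>m d - E)"
    "\<And>v. v \<in> carrier_vec d \<Longrightarrow>
      Re (((1\<^sub>m d - E) *\<^sub>v v) \<bullet>c v) \<le> (\<Sum>k\<in>I. (cmod (v \<bullet>c z k))\<^sup>2)"
    "\<And>v k c. v \<in> carrier_vec d \<Longrightarrow> k \<in> I \<Longrightarrow>
      Re ((E *\<^sub>v v) \<bullet>c v) \<le>
        Re ((v - complex_of_real c \<cdot>\<^sub>v z k) \<bullet>c (v - complex_of_real c \<cdot>\<^sub>v z k)) + c\<^sup>2"
proof -
  define S where "S = mat d d (\<lambda>(a, b). \<Sum>k\<in>I. z k $ a * cnj (z k $ b))"
  have S: "S \<in> carrier_mat d d" by (simp add: S_def)
  have Sv: "(S *\<^sub>v v) \<bullet>c w = (\<Sum>k\<in>I. (v \<bullet>c z k) * cnj (w \<bullet>c z k))"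
    if v: "v \<in> carrier_vec d" and w: "w \<in> carrier_vec d" for v w
  proof -
    have "(S *\<^sub>v v) \<bullet>c w = (\<Sum>a<d. \<Sum>b<d. \<Sum>k\<in>I. z k $ a * cnj (z k $ b) * v $ b * cnj (w $ a))"
      using v w by (simp add: S_def cscalar_prod_sum[of _ d] scalar_prod_def lessThan_atLeast0
          sum_distrib_right)
    also have "\<dots> = (\<Sum>a<d. \<Sum>k\<in>I. \<Sum>b<d. z k $ a * cnj (z k $ b) * v $ b * cnj (w $ a))"
      by (intro sum.cong refl sum.swap)
    also have "\<dots> = (\<Sum>k\<in>I. \<Sum>a<d. \<Sum>b<d. z k $ a * cnj (z k $ b) * v $ b * cnj (w $ a))"
      by (rule sum.swap)
    also have "\<dots> = (\<Sum>k\<in>I. (v \<bullet>c z k) * cnj (w \<bullet>c z k))"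
    proof (rule sum.cong[OF refl])
      fix k assume "k \<in> I"
      then have "(v \<bullet>c z k) * cnj (w \<bullet>c z k) =
          (\<Sum>b<d. v $ b * cnj (z k $ b)) * (\<Sum>a<d. cnj (w $ a) * z k $ a)"
        using z by (simp add: cscalar_prod_sum[of _ d])
      also have "\<dots> = (\<Sum>a<d. \<Sum>b<d. v $ b * cnj (z k $ b) * (cnj (w $ a) * z k $ a))"
        unfolding sum_product by (rule sum.swap)
      finally show "(\<Sum>a<d. \<Sum>b<d. z k $ a * cnj (z k $ b) * v $ b * cnj (w $ a)) =
          (v \<bullet>c z k) * cnj (w \<bullet>c z k)"
        by (simp add: mult_ac)
    qed
    finally show ?thesis .
  qed
  have Sq: "(S *\<^sub>v v) \<bullet>c v = complex_of_real (\<Sum>k\<in>I. (cmod (v \<bullet>c z k))\<^sup>2)"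
    if "v \<in> carrier_vec d" for v
    unfolding Sv[OF that that] by (simp only: of_real_sum complex_norm_square)
  have "psd d S"
    unfolding psd_def using S
    by (auto simp: Sq less_eq_complex_def sum_nonneg)
       (intro eq_matI, auto simp: S_def mult.commute)
  then obtain W s where W: "unitary_op d W" and SW: "S = of_spectrum d W s" and s: "\<And>k. 0 \<le> s k"
    using psd_spectral[OF \<open>psd d S\<close>] by blast
  define E where "E = of_spectrum d W (\<lambda>k. 1 / (1 + s k))"
  have s1: "0 < 1 + s k" for k using s[of k] by linarith
  have Ec: "E \<in> carrier_mat d d" using W by (simp add: E_def)
  have E: "psd d E" unfolding E_def using s1 by (intro psd_of_spectrum[OF W]) (simp add: less_imp_le)
  have E1: "1\<^sub>m d - E = of_spectrum d W (\<lambda>k. s k / (1 + s k))"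
    unfolding E_def of_spectrum_one[OF W, symmetric] of_spectrum_diff[OF W]
    using s1 by (intro of_spectrum_cong[OF W]) (simp add: field_simps less_imp_neq[symmetric])
  have "psd d (1\<^sub>m d - E)" unfolding E1 using s s1 by (intro psd_of_spectrum[OF W]) (simp add: less_imp_le)
  moreover have "Re (((1\<^sub>m d - E) *\<^sub>v v) \<bullet>c v) \<le> (\<Sum>k\<in>I. (cmod (v \<bullet>c z k))\<^sup>2)"
    if v: "v \<in> carrier_vec d" for v
  proof -
    have "s k / (1 + s k) \<le> s k" for k
      using s[of k] s1[of k] by (simp add: divide_le_eq algebra_simps)
    then have "Re (((1\<^sub>m d - E) *\<^sub>v v) \<bullet>c v) \<le> Re ((S *\<^sub>v v) \<bullet>c v)"
      unfolding E1 SW of_spectrum_quadratic_form[OF W v] Re_complex_of_real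
      by (intro sum_mono mult_right_mono) auto
    then show ?thesis by (simp add: Sq[OF v])
  qed
  moreover have "Re ((E *\<^sub>v v) \<bullet>c v) \<le>
      Re ((v - complex_of_real c \<cdot>\<^sub>v z k) \<bullet>c (v - complex_of_real c \<cdot>\<^sub>v z k)) + c\<^sup>2"
    if v: "v \<in> carrier_vec d" and k: "k \<in> I" for v k c
  proof -
    \<comment> \<open>Since v = u + S u, the number Re(u, v) equals |u|^2 plus the sum of all |(u,
      z_k)|^2. It also equals Re(u, y) + c Re(u, z_k). Twice the latter is at most |u|^2 + |y|^2 +
      c^2 + |(u, z_k)|^2, hence at most Re(u, v) + |y|^2 + c^2, and one copy of Re(u, v)
      cancels.\<close>
    define u where "u = E *\<^sub>v v"
    have u: "u \<in> carrier_vec d" using Ec v by (simp add: u_def)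
    define y where "y = v - complex_of_real c \<cdot>\<^sub>v z k"
    have y: "y \<in> carrier_vec d" using v z[OF k] by (simp add: y_def)
    have "1\<^sub>m d + S = of_spectrum d W (\<lambda>k. 1 + s k)"
      unfolding SW of_spectrum_one[OF W, symmetric] of_spectrum_add[OF W] ..
    then have "(1\<^sub>m d + S) * E = 1\<^sub>m d"
      unfolding E_def using s1 of_spectrum_cong[OF W, of "\<lambda>k. (1 + s k) * (1 / (1 + s k))" "\<lambda>_. 1"]
      by (simp add: of_spectrum_mult[OF W] of_spectrum_one[OF W] less_imp_neq[symmetric])
    then have "v = (1\<^sub>m d + S) *\<^sub>v u"
      unfolding u_def using v Ec S assoc_mult_mat_vec[of "1\<^sub>m d + S" d d E d v] by simp
    also have "\<dots> = u + S *\<^sub>v u"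
      using S u by (simp add: add_mult_distrib_mat_vec[of _ d d])
    finally have "v \<bullet>c u = u \<bullet>c u + (S *\<^sub>v u) \<bullet>c u"
      using S u by (metis add_scalar_prod_distrib carrier_vec_conjugate mult_mat_vec_carrier)
    moreover have "u \<bullet>c v = cnj (v \<bullet>c u)" by (rule cscalar_prod_commute[OF v u])
    ultimately have uv: "Re (u \<bullet>c v) = Re (u \<bullet>c u) + (\<Sum>k\<in>I. (cmod (u \<bullet>c z k))\<^sup>2)"
      by (simp add: Sq[OF u])
    have zk: "(cmod (u \<bullet>c z k))\<^sup>2 \<le> (\<Sum>k\<in>I. (cmod (u \<bullet>c z k))\<^sup>2)"
      using I k by (intro member_le_sum) auto
    have "u \<bullet>c y = u \<bullet>c v - complex_of_real c * (u \<bullet>c z k)"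
      unfolding y_def using u v z[OF k]
      by (simp add: cscalar_prod_sum[of _ d] algebra_simps sum_distrib_left sum_subtractf)
    moreover have "2 * Re (u \<bullet>c y) \<le> Re (u \<bullet>c u) + Re (y \<bullet>c y)"
    proof -
      have "0 \<le> Re ((u - y) \<bullet>c (u - y))"
        using conjugate_square_ge_0_vec[of "u - y"] by (simp add: less_eq_complex_def)
      also have "(u - y) \<bullet>c (u - y) = u \<bullet>c u + y \<bullet>c y - (u \<bullet>c y + y \<bullet>c u)"
        using u y by (simp add: cscalar_prod_sum[of _ d] algebra_simps sum.distrib sum_subtractf)
      finally show ?thesis using cscalar_prod_commute[OF u y] by simp
    qed
    moreover have "2 * (c * Re (u \<bullet>c z k)) \<le> c\<^sup>2 + (cmod (u \<bullet>c z k))\<^sup>2"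
    proof -
      have "2 * (c * Re (u \<bullet>c z k)) \<le> c\<^sup>2 + (Re (u \<bullet>c z k))\<^sup>2"
        using zero_le_power2[of "c - Re (u \<bullet>c z k)"] by (simp add: power2_eq_square algebra_simps)
      also have "(Re (u \<bullet>c z k))\<^sup>2 \<le> (cmod (u \<bullet>c z k))\<^sup>2"
        by (simp add: cmod_power2)
      finally show ?thesis by simp
    qed
    ultimately have "Re (u \<bullet>c v) \<le> Re (y \<bullet>c y) + c\<^sup>2"
      using uv zk by simp
    then show ?thesis by (simp add: u_def y_def)
  qed
  ultimately show ?thesis using that E by blast
qed

lemma of_spectrum_mult_vec_inner:
  assumes U: "unitary_op d U" and v: "v \<in> carrier_vec d" and k: "k < d"
  shows "(of_spectrum d U f *\<^sub>v v) \<bullet>c col U k = complex_of_real (f k) * (v \<bullet>c col U k)"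
proof -
  have u: "col U k \<in> carrier_vec d" using unitary_opD(1)[OF U] k by simp
  show ?thesis
    using cscalar_prod_mat_adjoint[OF of_spectrum_carrier[OF U] v u] u v unitary_opD(1)[OF U]
    by (simp add: mat_adjoint_of_spectrum[OF U] of_spectrum_col[OF U k]
        cscalar_prod_sum[of _ d] sum_distrib_left mult.left_commute)
qed

text \<open>
  The vectors fed into the test are multiples of the projections of the eigenvectors of the
  second family onto the span of those \<open>col U k\<close> whose eigenvalue is smaller.
\<close>

lemma test_error_le:
  assumes I: "finite I" and U: "unitary_op d U" and V: "\<And>i. i \<in> I \<Longrightarrow> unitary_op d (V i)"
    and l: "\<And>k. 0 \<le> l k" and m: "\<And>i k. i \<in> I \<Longrightarrow> 0 \<le> m i k" and t: "0 < t"
  obtains E where "psd d E" "psd d (1\<^sub>m d - E)"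
    "Re (op_trace (of_spectrum d U l * (1\<^sub>m d - E))) \<le>
      t * (\<Sum>i\<in>I. classical_error d U l (V i) (m i))"
    "\<And>i. i \<in> I \<Longrightarrow> Re (op_trace (of_spectrum d (V i) (m i) * E)) \<le>
      classical_error d U l (V i) (m i) + (\<Sum>j<d. m i j) / t"
proof -
  \<comment> \<open>The threshold decides which eigenvalue is the minimum. Below it the minimum is
    \<open>l k\<close>, and that part is charged to the first state; from it on the minimum is
    \<open>m i j\<close>, and that part remains as error of the second.\<close>
  define P where "P x = of_spectrum d U (\<lambda>k. if l k < x then 1 else 0)" for x
  define z where "z = (\<lambda>(i, j). complex_of_real (sqrt t) \<cdot>\<^sub>v (P (m i j) *\<^sub>v col (V i) j))"
  define J where "J = I \<times> {..<d}"
  note u = unitary_opD[OF U] and v = unitary_opD[OF V]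
  have uc: "col U k \<in> carrier_vec d" if "k < d" for k using u(1) that by simp
  have vc: "col (V i) j \<in> carrier_vec d" if "i \<in> I" "j < d" for i j using v(1) that by simp
  have P: "P x \<in> carrier_mat d d" for x using U by (simp add: P_def)
  have Pv: "P (m i j) *\<^sub>v col (V i) j \<in> carrier_vec d" if "i \<in> I" "j < d" for i j
    using mult_mat_vec_carrier[OF P vc[OF that]] .
  have zc: "z k \<in> carrier_vec d" if "k \<in> J" for k using that Pv by (auto simp: J_def z_def)
  have "finite J" using I by (simp add: J_def)
  from inverse_test_exists[of J z d, OF this zc] obtain E where E: "psd d E" "psd d (1\<^sub>m d - E)"
    and E1: "\<And>v. v \<in> carrier_vec d \<Longrightarrow>
      Re (((1\<^sub>m d - E) *\<^sub>v v) \<bullet>c v) \<le> (\<Sum>k\<in>J. (cmod (v \<bullet>c z k))\<^sup>2)"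
    and E2: "\<And>v k c. v \<in> carrier_vec d \<Longrightarrow> k \<in> J \<Longrightarrow>
      Re ((E *\<^sub>v v) \<bullet>c v) \<le>
        Re ((v - complex_of_real c \<cdot>\<^sub>v z k) \<bullet>c (v - complex_of_real c \<cdot>\<^sub>v z k)) + c\<^sup>2"
    by blast
  have Ec: "E \<in> carrier_mat d d" "1\<^sub>m d - E \<in> carrier_mat d d" using E by (auto simp: psd_def)
  have uz: "(cmod (col U k \<bullet>c z (i, j)))\<^sup>2 = (if l k < m i j then t * overlap U (V i) k j else 0)"
    if "i \<in> I" "j < d" "k < d" for i j k
  proof -
    have "cmod (col U k \<bullet>c z (i, j)) = cmod (z (i, j) \<bullet>c col U k)"
      using cscalar_prod_commute[of "col U k" d "z (i, j)"] uc zc that by (simp add: J_def)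
    also have "z (i, j) \<bullet>c col U k = complex_of_real (sqrt t) * ((P (m i j) *\<^sub>v col (V i) j) \<bullet>c col U k)"
      using Pv uc that by (simp add: z_def smult_scalar_prod_distrib[of _ d])
    also have "\<dots> = (if l k < m i j then complex_of_real (sqrt t) * (col (V i) j \<bullet>c col U k) else 0)"
      unfolding P_def of_spectrum_mult_vec_inner[OF U vc[OF that(1,2)] that(3)] by simp
    finally show ?thesis
      using overlap_cscalar_prod(1)[OF u(1) v(1) that(3,2)] t that(1)
      by (simp add: norm_mult power_mult_distrib)
  qed
  have "Re (op_trace (of_spectrum d U l * (1\<^sub>m d - E))) \<le>
      (\<Sum>k<d. l k * (\<Sum>x\<in>J. (cmod (col U k \<bullet>c z x))\<^sup>2))"
    unfolding op_trace_of_spectrum_mult[OF U Ec(2)]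
    using E1 uc l by (auto intro!: sum_mono mult_left_mono)
  also have "\<dots> = (\<Sum>k<d. \<Sum>i\<in>I. \<Sum>j<d. l k * (cmod (col U k \<bullet>c z (i, j)))\<^sup>2)"
    by (simp add: J_def sum.cartesian_product sum_distrib_left case_prod_unfold)
  also have "\<dots> = (\<Sum>k<d. \<Sum>i\<in>I. \<Sum>j<d. l k * (if l k < m i j then t * overlap U (V i) k j else 0))"
    by (simp add: uz)
  also have "\<dots> \<le> (\<Sum>k<d. \<Sum>i\<in>I. \<Sum>j<d. t * (min (l k) (m i j) * overlap U (V i) k j))"
    using t l m by (intro sum_mono) auto
  also have "\<dots> = (\<Sum>i\<in>I. \<Sum>k<d. \<Sum>j<d. t * (min (l k) (m i j) * overlap U (V i) k j))"
    by (rule sum.swap)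
  also have "\<dots> = t * (\<Sum>i\<in>I. classical_error d U l (V i) (m i))"
    by (simp add: classical_error_def sum_distrib_left)
  finally have R1: "Re (op_trace (of_spectrum d U l * (1\<^sub>m d - E))) \<le>
      t * (\<Sum>i\<in>I. classical_error d U l (V i) (m i))" .
  have R2: "Re (op_trace (of_spectrum d (V i) (m i) * E)) \<le>
      classical_error d U l (V i) (m i) + (\<Sum>j<d. m i j) / t" if i: "i \<in> I" for i
  proof -
    have bound: "Re ((E *\<^sub>v col (V i) j) \<bullet>c col (V i) j) \<le>
        (\<Sum>k<d. if l k < m i j then 0 else overlap U (V i) k j) + 1 / t" if j: "j < d" for j
    proof -
      let ?v = "col (V i) j"
      \<comment> \<open>The coefficient \<open>c = 1 / sqrt t\<close> undoes the scaling of
        \<open>z\<close>, so \<open>y\<close> is the complement of the projection and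
        \<open>c\<^sup>2\<close> is the term \<open>1 / t\<close>.\<close>
      define y where "y = ?v - complex_of_real (1 / sqrt t) \<cdot>\<^sub>v z (i, j)"
      have "complex_of_real (1 / sqrt t) \<cdot>\<^sub>v z (i, j) = P (m i j) *\<^sub>v ?v"
        using t by (simp add: z_def smult_smult_assoc flip: of_real_mult)
      then have y: "y = ?v - P (m i j) *\<^sub>v ?v" by (simp add: y_def)
      have yc: "y \<in> carrier_vec d" using y vc[OF i j] Pv[OF i j] by simp
      have "(cmod (y \<bullet>c col U k))\<^sup>2 = (if l k < m i j then 0 else overlap U (V i) k j)" if k: "k < d" for k
      proof -
        have "y \<bullet>c col U k = ?v \<bullet>c col U k - (P (m i j) *\<^sub>v ?v) \<bullet>c col U k"
          unfolding y using vc[OF i j] Pv[OF i j] uc[OF k] by (simp add: minus_scalar_prod_distrib[of _ d])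
        also have "\<dots> = (if l k < m i j then 0 else ?v \<bullet>c col U k)"
          unfolding P_def of_spectrum_mult_vec_inner[OF U vc[OF i j] k] by simp
        finally show ?thesis using overlap_cscalar_prod(1)[OF u(1) v(1)[OF i] k j] by simp
      qed
      then have "Re (y \<bullet>c y) = (\<Sum>k<d. if l k < m i j then 0 else overlap U (V i) k j)"
        using parseval[OF U yc] by simp
      moreover have "(1 / sqrt t)\<^sup>2 = 1 / t" using t by (simp add: power_divide)
      ultimately show ?thesis
        using E2[of ?v "(i, j)" "1 / sqrt t"] vc[OF i j] i j unfolding y_def[symmetric] by (simp add: J_def)
    qed
    have "Re (op_trace (of_spectrum d (V i) (m i) * E)) \<le>
        (\<Sum>j<d. m i j * ((\<Sum>k<d. if l k < m i j then 0 else overlap U (V i) k j) + 1 / t))"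
      unfolding op_trace_of_spectrum_mult[OF V[OF i] Ec(1)]
      using bound m[OF i] by (auto intro!: sum_mono mult_left_mono)
    also have "\<dots> = (\<Sum>j<d. \<Sum>k<d. if l k < m i j then 0 else m i j * overlap U (V i) k j) + (\<Sum>j<d. m i j) / t"
      by (simp add: distrib_left sum.distrib sum_distrib_left sum_divide_distrib if_distrib[of "\<lambda>x. _ * x"] cong: if_cong)
    also have "(\<Sum>j<d. \<Sum>k<d. if l k < m i j then 0 else m i j * overlap U (V i) k j) \<le>
        (\<Sum>j<d. \<Sum>k<d. min (l k) (m i j) * overlap U (V i) k j)"
      using l m[OF i] by (intro sum_mono) (auto simp: min_def)
    also have "\<dots> = classical_error d U l (V i) (m i)"
      unfolding classical_error_def by (rule sum.swap)
    finally show ?thesis by simp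
  qed
  show ?thesis using that E R1 R2 by blast
qed

section \<open>Tensor powers\<close>

text \<open>Splits an index of a tensor product into its two factors; for words, into the leading
  letter and the rest. Every induction over the tensor power below rests on this.\<close>

lemma sum_div_mod:
  fixes f :: "nat \<Rightarrow> nat \<Rightarrow> 'a :: comm_monoid_add"
  shows "(\<Sum>k<a * b. f (k div b) (k mod b)) = (\<Sum>i<a. \<Sum>j<b. f i j)"
proof (induction a)
  case (Suc a)
  have "{..<Suc a * b} = {..<a * b} \<union> (\<lambda>j. a * b + j) ` {..<b}"
  proof (rule Set.set_eqI, rule iffI)
    fix x assume "x \<in> {..<Suc a * b}"
    then show "x \<in> {..<a * b} \<union> (\<lambda>j. a * b + j) ` {..<b}"
      by (cases "x < a * b") (auto intro!: image_eqI[of _ _ "x - a * b"])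
  qed auto
  moreover have "{..<a * b} \<inter> (\<lambda>j. a * b + j) ` {..<b} = {}" by auto
  ultimately have "(\<Sum>k<Suc a * b. f (k div b) (k mod b)) =
      (\<Sum>k<a * b. f (k div b) (k mod b)) + (\<Sum>k\<in>(\<lambda>j. a * b + j) ` {..<b}. f (k div b) (k mod b))"
    by (simp add: sum.union_disjoint)
  also have "(\<Sum>k\<in>(\<lambda>j. a * b + j) ` {..<b}. f (k div b) (k mod b)) = (\<Sum>j<b. f a j)"
    by (subst sum.reindex) (auto simp: inj_on_def intro!: sum.cong)
  finally show ?case using Suc by simp
qed simp

lemma div_mod_less:
  fixes a b :: nat
  assumes "i < a * b"
  shows "i div b < a" "i mod b < b"
  using assms by (auto simp: less_mult_imp_div_less intro!: mod_less_divisor) (cases b; simp)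

lemma kron_carrier [simp]:
  "A \<in> carrier_mat a b \<Longrightarrow> B \<in> carrier_mat c e \<Longrightarrow> kron A B \<in> carrier_mat (a * c) (b * e)"
  by (auto simp: kron_def)

lemma index_kron:
  assumes "A \<in> carrier_mat a b" "B \<in> carrier_mat c e" "i < a * c" "j < b * e"
  shows "kron A B $$ (i, j) = A $$ (i div c, j div e) * B $$ (i mod c, j mod e)"
  using assms by (simp add: kron_def)

lemma kron_mult:
  assumes A: "A \<in> carrier_mat a b" and B: "B \<in> carrier_mat a' b'"
    and C: "C \<in> carrier_mat b c" and D: "D \<in> carrier_mat b' c'"
  shows "kron A B * kron C D = kron (A * C) (B * D)"
proof (rule eq_matI)
  have AB: "kron A B \<in> carrier_mat (a * a') (b * b')" and CD: "kron C D \<in> carrier_mat (b * b') (c * c')"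
    and AC: "A * C \<in> carrier_mat a c" and BD: "B * D \<in> carrier_mat a' c'"
    using assms by auto
  note K = kron_carrier[OF AC BD]
  fix i j assume "i < dim_row (kron (A * C) (B * D))" "j < dim_col (kron (A * C) (B * D))"
  then have ij: "i < a * a'" "j < c * c'" using K by auto
  note i = div_mod_less[OF ij(1)] and j = div_mod_less[OF ij(2)]
  have "(kron A B * kron C D) $$ (i, j) = (\<Sum>k<b * b'. kron A B $$ (i, k) * kron C D $$ (k, j))"
    using AB CD ij by (simp add: scalar_prod_def lessThan_atLeast0)
  also have "\<dots> = (\<Sum>k<b * b'. (\<lambda>x y. A $$ (i div a', x) * B $$ (i mod a', y) *
      (C $$ (x, j div c') * D $$ (y, j mod c'))) (k div b') (k mod b'))"
    using ij by (intro sum.cong) (auto simp: index_kron[OF A B] index_kron[OF C D])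
  also have "\<dots> = (\<Sum>x<b. \<Sum>y<b'. A $$ (i div a', x) * B $$ (i mod a', y) *
      (C $$ (x, j div c') * D $$ (y, j mod c')))"
    by (rule sum_div_mod)
  also have "\<dots> = (\<Sum>x<b. A $$ (i div a', x) * C $$ (x, j div c')) *
      (\<Sum>y<b'. B $$ (i mod a', y) * D $$ (y, j mod c'))"
    by (simp add: sum_product mult_ac)
  also have "\<dots> = (A * C) $$ (i div a', j div c') * (B * D) $$ (i mod a', j mod c')"
    using A B C D i j by (simp add: scalar_prod_def lessThan_atLeast0)
  also have "\<dots> = kron (A * C) (B * D) $$ (i, j)"
    using index_kron[OF AC BD ij] by simp
  finally show "(kron A B * kron C D) $$ (i, j) = kron (A * C) (B * D) $$ (i, j)" .
qed (use assms in \<open>auto simp: kron_def\<close>)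

lemma kron_mat_adjoint: "mat_adjoint (kron A B) = kron (mat_adjoint A) (mat_adjoint B)"
proof (rule eq_matI)
  fix i j
  assume "i < dim_row (kron (mat_adjoint A) (mat_adjoint B))" "j < dim_col (kron (mat_adjoint A) (mat_adjoint B))"
  then have ij: "i < dim_col A * dim_col B" "j < dim_row A * dim_row B" by (auto simp: kron_def)
  then show "mat_adjoint (kron A B) $$ (i, j) = kron (mat_adjoint A) (mat_adjoint B) $$ (i, j)"
    using div_mod_less[OF ij(1)] div_mod_less[OF ij(2)] by (simp add: kron_def)
qed (auto simp: kron_def)

lemma mod_eq_div_eq_iff:
  fixes i j b :: nat
  shows "i div b = j div b \<and> i mod b = j mod b \<longleftrightarrow> i = j"
  by (metis div_mult_mod_eq)

lemma kron_mat_diag: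
  "kron (mat_diag a f) (mat_diag b g) = mat_diag (a * b) (\<lambda>i. f (i div b) * g (i mod b))"
proof (rule eq_matI)
  fix i j
  assume "i < dim_row (mat_diag (a * b) (\<lambda>i. f (i div b) * g (i mod b)))"
    "j < dim_col (mat_diag (a * b) (\<lambda>i. f (i div b) * g (i mod b)))"
  then have ij: "i < a * b" "j < a * b" by (auto simp: mat_diag_def)
  then show "kron (mat_diag a f) (mat_diag b g) $$ (i, j) =
      mat_diag (a * b) (\<lambda>i. f (i div b) * g (i mod b)) $$ (i, j)"
    using div_mod_less[OF ij(1)] div_mod_less[OF ij(2)] mod_eq_div_eq_iff[of i b j]
    by (auto simp: kron_def mat_diag_def)
qed (auto simp: kron_def mat_diag_def)

lemma kron_one: "kron (1\<^sub>m a) (1\<^sub>m b) = 1\<^sub>m (a * b)"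
  using kron_mat_diag[of a "\<lambda>_. 1" b "\<lambda>_. 1"] by simp

lemma tensor_pow_carrier [simp]:
  "A \<in> carrier_mat d d \<Longrightarrow> tensor_pow A n \<in> carrier_mat (d ^ n) (d ^ n)"
  by (induction n) auto

lemma tensor_pow_mult:
  assumes "A \<in> carrier_mat d d" "B \<in> carrier_mat d d"
  shows "tensor_pow (A * B) n = tensor_pow A n * tensor_pow B n"
proof (induction n)
  case (Suc n)
  then show ?case
    using kron_mult[OF assms(1) tensor_pow_carrier[OF assms(1)] assms(2) tensor_pow_carrier[OF assms(2)]]
    by simp
qed simp

lemma tensor_pow_one: "tensor_pow (1\<^sub>m d) n = 1\<^sub>m (d ^ n)"
  by (induction n) (auto simp: kron_one)

lemma tensor_pow_mat_adjoint: "tensor_pow (mat_adjoint A) n = mat_adjoint (tensor_pow A n)"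
  by (induction n) (auto simp: kron_mat_adjoint)

lemma unitary_op_tensor_pow:
  assumes "unitary_op d U"
  shows "unitary_op (d ^ n) (tensor_pow U n)"
proof -
  note u = unitary_opD[OF assms]
  have "mat_adjoint (tensor_pow U n) * tensor_pow U n = 1\<^sub>m (d ^ n)"
    using tensor_pow_mult[OF mat_adjoint_carrier[OF u(1)] u(1), of n] u
    by (simp add: tensor_pow_mat_adjoint tensor_pow_one)
  then show ?thesis using u(1) by (intro unitary_opI_left) auto
qed

text \<open>Basis indices below \<open>d ^ n\<close> are read as words of length \<open>n\<close>, most significant letter first.\<close>

fun word_prod :: "nat \<Rightarrow> (nat \<Rightarrow> real) \<Rightarrow> nat \<Rightarrow> nat \<Rightarrow> real" where
  "word_prod d f 0 i = 1"
| "word_prod d f (Suc n) i = f (i div d ^ n) * word_prod d f n (i mod d ^ n)"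

text \<open>A product weight on pairs of words. The two words keep separate indices because they
  label two different eigenbases.\<close>

fun word_prod2 :: "nat \<Rightarrow> (nat \<Rightarrow> nat \<Rightarrow> real) \<Rightarrow> nat \<Rightarrow> nat \<Rightarrow> nat \<Rightarrow> real" where
  "word_prod2 d f 0 i j = 1"
| "word_prod2 d f (Suc n) i j = f (i div d ^ n) (j div d ^ n) * word_prod2 d f n (i mod d ^ n) (j mod d ^ n)"

lemma tensor_pow_of_spectrum:
  assumes "unitary_op d U"
  shows "tensor_pow (of_spectrum d U l) n = of_spectrum (d ^ n) (tensor_pow U n) (word_prod d l n)"
proof (induction n)
  case 0
  then show ?case by (simp add: of_spectrum_def)
next
  case (Suc n)
  note u = unitary_opD[OF assms]
  let ?W = "tensor_pow U n" and ?D = "\<lambda>d l. mat_diag d (\<lambda>i. complex_of_real (l i))"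
  have W: "?W \<in> carrier_mat (d ^ n) (d ^ n)" using u(1) by simp
  have "tensor_pow (of_spectrum d U l) (Suc n) = kron (U * ?D d l * mat_adjoint U)
      (?W * ?D (d ^ n) (word_prod d l n) * mat_adjoint ?W)"
    using Suc by (simp add: of_spectrum_def)
  also have "\<dots> = kron U ?W * kron (?D d l) (?D (d ^ n) (word_prod d l n)) * kron (mat_adjoint U) (mat_adjoint ?W)"
    using u(1) W by (simp add: kron_mult[of _ d d _ "d ^ n" "d ^ n" _ d _ "d ^ n"] mult_carrier_mat[of _ d d _ d]
        mult_carrier_mat[of _ "d ^ n" "d ^ n" _ "d ^ n"])
  also have "\<dots> = of_spectrum (d ^ Suc n) (tensor_pow U (Suc n)) (word_prod d l (Suc n))"
    by (simp add: of_spectrum_def kron_mat_adjoint kron_mat_diag)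
  finally show ?case .
qed

text \<open>Adjoints and products pass through \<open>tensor_pow\<close>, so only the entries of the
  tensor power of the single matrix \<open>mat_adjoint U * V\<close> have to be followed.\<close>

lemma overlap_tensor_pow:
  assumes "U \<in> carrier_mat d d" "V \<in> carrier_mat d d" "i < d ^ n" "j < d ^ n"
  shows "overlap (tensor_pow U n) (tensor_pow V n) i j = word_prod2 d (overlap U V) n i j"
proof -
  define M where "M = mat_adjoint U * V"
  have M: "M \<in> carrier_mat d d" using assms mult_carrier_mat[OF mat_adjoint_carrier] by (auto simp: M_def)
  have "(cmod (tensor_pow M n $$ (i, j)))\<^sup>2 = word_prod2 d (\<lambda>i j. (cmod (M $$ (i, j)))\<^sup>2) n i j"
    if "i < d ^ n" "j < d ^ n" for i j n
    using that
  proof (induction n arbitrary: i j)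
    case (Suc n)
    then have ij: "i < d * d ^ n" "j < d * d ^ n" by auto
    show ?case
      using index_kron[OF M tensor_pow_carrier[OF M] ij] Suc.IH div_mod_less[OF ij(1)] div_mod_less[OF ij(2)]
      by (simp add: norm_mult power_mult_distrib)
  qed simp
  moreover have "mat_adjoint (tensor_pow U n) * tensor_pow V n = tensor_pow M n"
    using assms by (simp add: M_def tensor_pow_mult[of _ d] tensor_pow_mat_adjoint)
  ultimately show ?thesis using assms by (simp add: overlap_def[abs_def] M_def)
qed

lemma word_prod_nonneg: "(\<And>k. 0 \<le> f k) \<Longrightarrow> 0 \<le> word_prod d f n i"
  by (induction n arbitrary: i) auto

lemma word_prod2_nonneg: "(\<And>i j. 0 \<le> f i j) \<Longrightarrow> 0 \<le> word_prod2 d f n i j"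
  by (induction n arbitrary: i j) auto

section \<open>The classical problem on words\<close>

lemma sum_words_Suc:
  fixes h :: "nat \<Rightarrow> nat \<Rightarrow> nat \<Rightarrow> nat \<Rightarrow> real"
  shows "(\<Sum>i<d ^ Suc n. \<Sum>j<d ^ Suc n. h (i div d ^ n) (j div d ^ n) (i mod d ^ n) (j mod d ^ n)) =
    (\<Sum>a<d. \<Sum>b<d. \<Sum>i<d ^ n. \<Sum>j<d ^ n. h a b i j)"
proof -
  have "(\<Sum>i<d ^ Suc n. \<Sum>j<d ^ Suc n. h (i div d ^ n) (j div d ^ n) (i mod d ^ n) (j mod d ^ n)) =
      (\<Sum>i<d * d ^ n. (\<lambda>a i. \<Sum>b<d. \<Sum>j<d ^ n. h a b i j) (i div d ^ n) (i mod d ^ n))"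
    unfolding power_Suc by (rule sum.cong[OF refl], rule sum_div_mod)
  also have "\<dots> = (\<Sum>a<d. \<Sum>i<d ^ n. \<Sum>b<d. \<Sum>j<d ^ n. h a b i j)"
    by (rule sum_div_mod)
  also have "\<dots> = (\<Sum>a<d. \<Sum>b<d. \<Sum>i<d ^ n. \<Sum>j<d ^ n. h a b i j)"
    by (rule sum.cong[OF refl], rule sum.swap)
  finally show ?thesis .
qed

lemma sum_word_prod2_Suc:
  fixes f g :: "nat \<Rightarrow> nat \<Rightarrow> real"
  shows "(\<Sum>i<d ^ Suc n. \<Sum>j<d ^ Suc n. f (i div d ^ n) (j div d ^ n) * g (i mod d ^ n) (j mod d ^ n)) =
    (\<Sum>a<d. \<Sum>b<d. f a b) * (\<Sum>i<d ^ n. \<Sum>j<d ^ n. g i j)"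
  unfolding sum_words_Suc[where h = "\<lambda>a b i j. f a b * g i j"]
  by (simp flip: sum_distrib_left sum_distrib_right)

lemma sum_word_prod2: "(\<Sum>i<d ^ n. \<Sum>j<d ^ n. word_prod2 d f n i j) = (\<Sum>a<d. \<Sum>b<d. f a b) ^ n"
proof (induction n)
  case (Suc n)
  then show ?case using sum_word_prod2_Suc[where f = f and g = "word_prod2 d f n" and n = n] by simp
qed simp

lemma sum_word_prod: "(\<Sum>i<d ^ n. word_prod d f n i) = (\<Sum>a<d. f a) ^ n"
proof (induction n)
  case (Suc n)
  then show ?case
    using sum_div_mod[where f = "\<lambda>a i. f a * word_prod d f n i" and a = d and b = "d ^ n"]
    by (simp add: sum_product[symmetric])
qed simp

text \<open>The additive counterpart of \<open>word_prod2\<close>: with \<open>f\<close> the centred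
  log-likelihood ratio of one pair of letters, this is the centred log-likelihood ratio of a pair of
  words.\<close>

fun word_sum2 :: "nat \<Rightarrow> (nat \<Rightarrow> nat \<Rightarrow> real) \<Rightarrow> nat \<Rightarrow> nat \<Rightarrow> nat \<Rightarrow> real" where
  "word_sum2 d f 0 i j = 0"
| "word_sum2 d f (Suc n) i j = f (i div d ^ n) (j div d ^ n) + word_sum2 d f n (i mod d ^ n) (j mod d ^ n)"

text \<open>Mean and variance of a sum of independent centred variables under the product
  distribution of \<open>R\<close>. The mixed term of the square factors and vanishes because
  \<open>g\<close> has mean zero.\<close>

lemma word_sum2_moments:
  assumes R: "(\<Sum>a<d. \<Sum>b<d. R a b) = 1" and g: "(\<Sum>a<d. \<Sum>b<d. R a b * g a b) = 0"
  shows "(\<Sum>i<d ^ n. \<Sum>j<d ^ n. word_prod2 d R n i j * word_sum2 d g n i j) = 0"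
    and "(\<Sum>i<d ^ n. \<Sum>j<d ^ n. word_prod2 d R n i j * (word_sum2 d g n i j)\<^sup>2) =
      real n * (\<Sum>a<d. \<Sum>b<d. R a b * (g a b)\<^sup>2)"
proof (induction n)
  let ?P = "word_prod2 d R" and ?S = "word_sum2 d g"
  case (Suc n)
  have P1: "(\<Sum>i<d ^ n. \<Sum>j<d ^ n. ?P n i j) = 1" by (simp add: sum_word_prod2 R)
  {
    case 1
    have "(\<Sum>i<d ^ Suc n. \<Sum>j<d ^ Suc n. ?P (Suc n) i j * ?S (Suc n) i j) =
        (\<Sum>i<d ^ Suc n. \<Sum>j<d ^ Suc n. (R (i div d ^ n) (j div d ^ n) * g (i div d ^ n) (j div d ^ n)) *
          ?P n (i mod d ^ n) (j mod d ^ n)) +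
        (\<Sum>i<d ^ Suc n. \<Sum>j<d ^ Suc n. R (i div d ^ n) (j div d ^ n) *
          (?P n (i mod d ^ n) (j mod d ^ n) * ?S n (i mod d ^ n) (j mod d ^ n)))"
      by (simp add: distrib_left mult_ac sum.distrib del: power_Suc)
    also have "\<dots> = 0"
      unfolding sum_word_prod2_Suc[where f = "\<lambda>a b. R a b * g a b"]
        sum_word_prod2_Suc[where f = R and g = "\<lambda>i j. ?P n i j * ?S n i j"]
      using Suc g by simp
    finally show ?case .
  next
    case 2
    have "(\<Sum>i<d ^ Suc n. \<Sum>j<d ^ Suc n. ?P (Suc n) i j * (?S (Suc n) i j)\<^sup>2) =
        (\<Sum>i<d ^ Suc n. \<Sum>j<d ^ Suc n. (R (i div d ^ n) (j div d ^ n) * (g (i div d ^ n) (j div d ^ n))\<^sup>2) *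
          ?P n (i mod d ^ n) (j mod d ^ n)) +
        (\<Sum>i<d ^ Suc n. \<Sum>j<d ^ Suc n. (R (i div d ^ n) (j div d ^ n) * g (i div d ^ n) (j div d ^ n)) *
          (2 * (?P n (i mod d ^ n) (j mod d ^ n) * ?S n (i mod d ^ n) (j mod d ^ n)))) +
        (\<Sum>i<d ^ Suc n. \<Sum>j<d ^ Suc n. R (i div d ^ n) (j div d ^ n) *
          (?P n (i mod d ^ n) (j mod d ^ n) * (?S n (i mod d ^ n) (j mod d ^ n))\<^sup>2))"
      unfolding sum.distrib[symmetric] by (intro sum.cong refl) (simp add: power2_eq_square algebra_simps)
    also have "\<dots> = real (Suc n) * (\<Sum>a<d. \<Sum>b<d. R a b * (g a b)\<^sup>2)"
      unfolding sum_word_prod2_Suc[where f = "\<lambda>a b. R a b * (g a b)\<^sup>2"]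
        sum_word_prod2_Suc[where f = "\<lambda>a b. R a b * g a b" and g = "\<lambda>i j. 2 * (?P n i j * ?S n i j)"]
        sum_word_prod2_Suc[where f = R and g = "\<lambda>i j. ?P n i j * (?S n i j)\<^sup>2"]
      using Suc g R P1 by (simp add: algebra_simps)
    finally show ?case .
  }
qed simp_all

text \<open>The trace of the product of the powers \<open>s\<close> and \<open>1 - s\<close> of two
  states, in their eigenbases with overlaps \<open>w\<close>. Since \<open>0 powr 0 = 0\<close>, the
  endpoints respect the support convention.\<close>

definition chernoff_sum ::
  "nat \<Rightarrow> (nat \<Rightarrow> real) \<Rightarrow> (nat \<Rightarrow> real) \<Rightarrow> (nat \<Rightarrow> nat \<Rightarrow> real) \<Rightarrow> real \<Rightarrow> real" where
  "chernoff_sum d l m w s = (\<Sum>a<d. \<Sum>b<d. l a powr s * m b powr (1 - s) * w a b)"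

lemma word_prod_powr:
  assumes "\<And>k. 0 \<le> l k"
  shows "word_prod d l n i powr s = word_prod d (\<lambda>k. l k powr s) n i"
  by (induction n arbitrary: i) (auto simp: powr_mult assms word_prod_nonneg)

text \<open>Both arguments dominate the minimum and the two exponents sum to 1. A zero argument is
  treated apart because \<open>0 powr 0 = 0\<close>; the minimum is then 0.\<close>

lemma min_le_powr_mult:
  assumes "0 \<le> x" "0 \<le> y" "0 \<le> s" "s \<le> (1::real)"
  shows "min x y \<le> x powr s * y powr (1 - s)"
proof (cases "x = 0 \<or> y = 0")
  case False
  have "min x y = min x y powr s * min x y powr (1 - s)"
    using False assms by (simp flip: powr_add)
  also have "\<dots> \<le> x powr s * y powr (1 - s)"
    using assms by (intro mult_mono powr_mono2) auto
  finally show ?thesis .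
qed (use assms in auto)

lemma word_prod2_split:
  "word_prod2 d (\<lambda>a b. f a * g b * w a b) n i j = word_prod d f n i * word_prod d g n j * word_prod2 d w n i j"
  by (induction n arbitrary: i j) auto

text \<open>The weighted geometric mean that bounds the minimum is multiplicative along words, so
  the sum of the bounds is an exact \<open>n\<close>-th power.\<close>

lemma sum_min_le_chernoff_sum:
  assumes l: "\<And>k. 0 \<le> l k" and m: "\<And>k. 0 \<le> m k" and w: "\<And>i j. 0 \<le> w i j"
    and s: "0 \<le> s" "s \<le> 1"
  shows "(\<Sum>i<d ^ n. \<Sum>j<d ^ n. min (word_prod d l n i) (word_prod d m n j) * word_prod2 d w n i j) \<le>
    chernoff_sum d l m w s ^ n"
proof -
  have "(\<Sum>i<d ^ n. \<Sum>j<d ^ n. min (word_prod d l n i) (word_prod d m n j) * word_prod2 d w n i j) \<le>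
    (\<Sum>i<d ^ n. \<Sum>j<d ^ n. word_prod2 d (\<lambda>a b. l a powr s * m b powr (1 - s) * w a b) n i j)"
    unfolding word_prod2_split word_prod_powr[OF l, symmetric] word_prod_powr[OF m, symmetric]
    by (intro sum_mono mult_right_mono min_le_powr_mult word_prod_nonneg word_prod2_nonneg l m w s)
  then show ?thesis by (simp add: sum_word_prod2 chernoff_sum_def)
qed

lemma chernoff_sum_nonneg:
  assumes "\<And>i j. 0 \<le> w i j"
  shows "0 \<le> chernoff_sum d l m w s"
  unfolding chernoff_sum_def using assms by (intro sum_nonneg mult_nonneg_nonneg) auto

lemma chernoff_sum_has_derivative:
  assumes l: "\<And>k. 0 \<le> l k" and m: "\<And>k. 0 \<le> m k"
  shows "(chernoff_sum d l m w has_real_derivative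
    (\<Sum>a<d. \<Sum>b<d. l a powr s * m b powr (1 - s) * w a b * (ln (l a) - ln (m b)))) (at s)"
proof -
  \<comment> \<open>A term with a zero eigenvalue is 0 for every exponent, so the sum is
    differentiable on the whole real line, including the endpoints 0 and 1.\<close>
  have "((\<lambda>s. l a powr s * m b powr (1 - s) * w a b) has_real_derivative
      l a powr s * m b powr (1 - s) * w a b * (ln (l a) - ln (m b))) (at s)" for a b
  proof (cases "l a = 0 \<or> m b = 0")
    case False
    then have "0 < l a" "0 < m b" using l[of a] m[of b] by auto
    then show ?thesis
      by (auto simp: powr_def algebra_simps intro!: derivative_eq_intros)
  qed auto
  then show ?thesis
    unfolding chernoff_sum_def[abs_def] by (intro DERIV_sum)
qed

lemma chernoff_sum_attains_min:
  assumes "\<And>k. 0 \<le> l k" "\<And>k. 0 \<le> m k"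
  obtains s where "0 \<le> s" "s \<le> 1" "\<And>t. 0 \<le> t \<Longrightarrow> t \<le> 1 \<Longrightarrow> chernoff_sum d l m w s \<le> chernoff_sum d l m w t"
proof -
  have "isCont (chernoff_sum d l m w) t" for t
    using chernoff_sum_has_derivative[of l m, OF assms] by (rule DERIV_isCont)
  then show ?thesis
    using isCont_eq_Lb[of 0 1 "chernoff_sum d l m w"] that by auto
qed

text \<open>
  Exponential tilting towards \<open>R\<close>; the sign conditions on the mean log-likelihood ratio are the
  first-order optimality conditions for the minimizing exponent, and the last step is Jensen's
  inequality for \<open>exp\<close> together with \<open>E \<bar>X\<bar> \<le> sqrt (E X\<^sup>2)\<close>.
\<close>

lemma sum_min_ge_chernoff_sum:
  assumes l: "\<And>k. 0 \<le> l k" and m: "\<And>k. 0 \<le> m k" and w: "\<And>i j. 0 \<le> w i j"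
    and s: "0 \<le> s" "s \<le> 1"
    and min: "\<And>t. 0 \<le> t \<Longrightarrow> t \<le> 1 \<Longrightarrow> chernoff_sum d l m w s \<le> chernoff_sum d l m w t"
    and pos: "0 < chernoff_sum d l m w s"
  obtains K where "\<And>n. chernoff_sum d l m w s ^ n * exp (- sqrt (real n * K)) \<le>
    (\<Sum>i<d ^ n. \<Sum>j<d ^ n. min (word_prod d l n i) (word_prod d m n j) * word_prod2 d w n i j)"
proof -
  define F where "F = chernoff_sum d l m w s"
  \<comment> \<open>The tilted distribution on pairs of letters; \<open>\<mu>\<close>, the mean of
    the log-likelihood ratio under it, is the logarithmic derivative of \<open>chernoff_sum\<close>
    at \<open>s\<close>.\<close>
  define R where "R a b = l a powr s * m b powr (1 - s) * w a b / F" for a b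
  define \<mu> where "\<mu> = (\<Sum>a<d. \<Sum>b<d. R a b * (ln (l a) - ln (m b)))"
  define g where "g a b = ln (l a) - ln (m b) - \<mu>" for a b
  have F: "0 < F" using pos by (simp add: F_def)
  have R0: "0 \<le> R a b" for a b using F w by (simp add: R_def)
  have R1: "(\<Sum>a<d. \<Sum>b<d. R a b) = 1"
    using F by (simp add: R_def F_def chernoff_sum_def flip: sum_divide_distrib)
  have g0: "(\<Sum>a<d. \<Sum>b<d. R a b * g a b) = 0"
  proof -
    have "(\<Sum>a<d. \<Sum>b<d. R a b * g a b) = \<mu> - (\<Sum>a<d. \<Sum>b<d. R a b) * \<mu>"
      by (simp add: g_def \<mu>_def right_diff_distrib sum_subtractf sum_distrib_right)
    then show ?thesis using R1 by simp
  qed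
  have deriv: "(chernoff_sum d l m w has_real_derivative F * \<mu>) (at s)"
  proof -
    have "F * \<mu> = (\<Sum>a<d. \<Sum>b<d. l a powr s * m b powr (1 - s) * w a b * (ln (l a) - ln (m b)))"
      using F by (simp add: \<mu>_def R_def sum_distrib_left)
    then show ?thesis using chernoff_sum_has_derivative[of l m, OF l m] by simp
  qed
  have \<mu>1: "0 \<le> \<mu>" if "s < 1"
  proof (rule ccontr)
    assume "\<not> 0 \<le> \<mu>"
    then have "F * \<mu> < 0" using F by (simp add: mult_pos_neg)
    from DERIV_neg_dec_right[OF deriv this] obtain \<delta> where \<delta>: "0 < \<delta>"
      "\<And>h. 0 < h \<Longrightarrow> h < \<delta> \<Longrightarrow> chernoff_sum d l m w (s + h) < chernoff_sum d l m w s" by blast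
    define h where "h = min (\<delta> / 2) (1 - s)"
    have "0 < h" "h < \<delta>" "s + h \<le> 1" using \<delta>(1) that by (auto simp: h_def)
    then show False using \<delta>(2)[of h] min[of "s + h"] s by auto
  qed
  have \<mu>2: "\<mu> \<le> 0" if "0 < s"
  proof (rule ccontr)
    assume "\<not> \<mu> \<le> 0"
    then have "0 < F * \<mu>" using F by simp
    from DERIV_pos_inc_left[OF deriv this] obtain \<delta> where \<delta>: "0 < \<delta>"
      "\<And>h. 0 < h \<Longrightarrow> h < \<delta> \<Longrightarrow> chernoff_sum d l m w (s - h) < chernoff_sum d l m w s" by blast
    define h where "h = min (\<delta> / 2) s"
    have "0 < h" "h < \<delta>" "0 \<le> s - h" using \<delta>(1) that by (auto simp: h_def)
    then show False using \<delta>(2)[of h] min[of "s - h"] s by auto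
  qed
  \<comment> \<open>An interior minimizer has \<open>\<mu> = 0\<close>. At an endpoint only one sign
    of \<open>\<mu>\<close> is known, and the factor in the other inequality is 0.\<close>
  have sgn: "0 \<le> (1 - s) * \<mu>" "s * \<mu> \<le> 0"
    using \<mu>1 \<mu>2 s by (cases "s < 1"; simp add: mult_nonneg_nonneg)
      (cases "0 < s"; use \<mu>2 s in \<open>simp add: mult_nonneg_nonpos\<close>)
  \<comment> \<open>Undoing the tilting with exponent \<open>1 - s\<close> or \<open>- s\<close>
    recovers \<open>l a * w a b\<close> or \<open>m b * w a b\<close> up to a factor of the form
    \<open>exp\<close> of a nonpositive number, by \<open>sgn\<close>.\<close>
  have base: "F * R a b * exp ((1 - s) * g a b) \<le> l a * w a b \<and> F * R a b * exp (- s * g a b) \<le> m b * w a b"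
    for a b
  proof (cases "l a = 0 \<or> m b = 0")
    case True
    then show ?thesis using l m w by (auto simp: R_def)
  next
    case False
    then have lm: "0 < l a" "0 < m b" using l[of a] m[of b] by auto
    have "F * R a b * exp ((1 - s) * g a b) = l a * w a b * exp (- ((1 - s) * \<mu>))"
    proof -
      have "l a powr s * m b powr (1 - s) * exp ((1 - s) * g a b) =
          exp (s * ln (l a) + (1 - s) * ln (m b) + (1 - s) * g a b)"
        using lm by (simp add: powr_def flip: exp_add)
      also have "s * ln (l a) + (1 - s) * ln (m b) + (1 - s) * g a b = ln (l a) + - ((1 - s) * \<mu>)"
        by (simp add: g_def algebra_simps)
      also have "exp \<dots> = l a * exp (- ((1 - s) * \<mu>))"
        using lm by (simp only: exp_add exp_ln)
      finally show ?thesis using F by (simp add: R_def mult_ac)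
    qed
    moreover have "F * R a b * exp (- s * g a b) = m b * w a b * exp (s * \<mu>)"
    proof -
      have "l a powr s * m b powr (1 - s) * exp (- s * g a b) =
          exp (s * ln (l a) + (1 - s) * ln (m b) + - s * g a b)"
        using lm by (simp add: powr_def flip: exp_add)
      also have "s * ln (l a) + (1 - s) * ln (m b) + - s * g a b = ln (m b) + s * \<mu>"
        by (simp add: g_def algebra_simps)
      also have "exp \<dots> = m b * exp (s * \<mu>)" using lm by (simp add: exp_add)
      finally show ?thesis using F by (simp add: R_def mult_ac)
    qed
    ultimately show ?thesis
      using sgn lm w by (auto intro!: mult_left_le)
  qed
  have words: "F ^ n * word_prod2 d R n i j * exp ((1 - s) * word_sum2 d g n i j) \<le> word_prod d l n i * word_prod2 d w n i j
      \<and> F ^ n * word_prod2 d R n i j * exp (- s * word_sum2 d g n i j) \<le> word_prod d m n j * word_prod2 d w n i j"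
    for n i j
  proof (induction n arbitrary: i j)
    case (Suc n)
    let ?i = "i div d ^ n" and ?j = "j div d ^ n" and ?i' = "i mod d ^ n" and ?j' = "j mod d ^ n"
    have "(F * R ?i ?j * exp (c * g ?i ?j)) * (F ^ n * word_prod2 d R n ?i' ?j' * exp (c * word_sum2 d g n ?i' ?j')) \<le> x * y"
      if "F * R ?i ?j * exp (c * g ?i ?j) \<le> x"
        "F ^ n * word_prod2 d R n ?i' ?j' * exp (c * word_sum2 d g n ?i' ?j') \<le> y" for c x y
      using that F R0 word_prod2_nonneg[of R, OF R0]
      by (intro mult_mono) (auto intro: order_trans[rotated])
    from this[of "1 - s", OF conjunct1[OF base] conjunct1[OF Suc.IH]]
      this[of "- s", OF conjunct2[OF base] conjunct2[OF Suc.IH]]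
    show ?case by (simp add: distrib_left exp_add exp_diff exp_minus field_simps)
  qed simp
  \<comment> \<open>The variance under \<open>R\<close>, increased by 1 so that
    \<open>x = sqrt (real n * K)\<close> is positive and may be divided by.\<close>
  define K where "K = (\<Sum>a<d. \<Sum>b<d. R a b * (g a b)\<^sup>2) + 1"
  have K: "1 \<le> K" unfolding K_def using R0 by (auto intro!: sum_nonneg)
  have "F ^ n * exp (- sqrt (real n * K)) \<le>
    (\<Sum>i<d ^ n. \<Sum>j<d ^ n. min (word_prod d l n i) (word_prod d m n j) * word_prod2 d w n i j)" for n
  proof (cases "n = 0")
    case False
    let ?P = "word_prod2 d R n" and ?S = "word_sum2 d g n"
    define x where "x = sqrt (real n * K)"
    have x: "0 < x" "x\<^sup>2 = real n * K" using False K by (auto simp: x_def)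
    \<comment> \<open>From \<open>\<bar>S\<bar> \<le> (S\<^sup>2 / x + x) / 2\<close> and
      \<open>1 + z \<le> exp z\<close> at \<open>z = x - \<bar>S\<bar>\<close> comes a lower bound
      for \<open>exp (- \<bar>S\<bar>)\<close> that is affine in \<open>S\<^sup>2\<close>. Summing
      it requires only the second moment, which is at most \<open>x\<^sup>2\<close>, so the bracket
      stays at least 1.\<close>
    have pt: "F ^ n * (exp (- x) * ((1 + x / 2) * ?P i j - ?P i j * (?S i j)\<^sup>2 / (2 * x))) \<le>
        min (word_prod d l n i) (word_prod d m n j) * word_prod2 d w n i j" for i j
    proof -
      let ?y = "\<bar>?S i j\<bar>"
      have P0: "0 \<le> F ^ n * ?P i j" using F word_prod2_nonneg[of R, OF R0] by simp
      have "?y \<le> (?y\<^sup>2 / x + x) / 2"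
        using zero_le_power2[of "?y - x"] x(1) by (simp add: field_simps power2_eq_square)
      then have "(1 + x / 2) - ?y\<^sup>2 / (2 * x) \<le> 1 + (x - ?y)" by (simp add: field_simps)
      also have "\<dots> \<le> exp (x - ?y)" by (rule exp_ge_add_one_self)
      finally have "exp (- x) * ((1 + x / 2) - ?y\<^sup>2 / (2 * x)) \<le> exp (- x) * exp (x - ?y)" by simp
      also have "\<dots> = exp (- ?y)" by (simp flip: exp_add)
      finally have "F ^ n * ?P i j * (exp (- x) * ((1 + x / 2) - ?y\<^sup>2 / (2 * x))) \<le> F ^ n * ?P i j * exp (- ?y)"
        using P0 by (rule mult_left_mono)
      also have "\<dots> \<le> min (word_prod d l n i * word_prod2 d w n i j) (word_prod d m n j * word_prod2 d w n i j)"
      proof (rule min.boundedI)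
        have "- ?y \<le> (1 - s) * ?S i j" "- ?y \<le> - s * ?S i j"
        proof -
          have "\<bar>(1 - s) * ?S i j\<bar> \<le> ?y" "\<bar>- s * ?S i j\<bar> \<le> ?y"
            using s by (simp_all add: abs_mult mult_left_le_one_le)
          then show "- ?y \<le> (1 - s) * ?S i j" "- ?y \<le> - s * ?S i j" by linarith+
        qed
        then have "F ^ n * ?P i j * exp (- ?y) \<le> F ^ n * ?P i j * exp ((1 - s) * ?S i j)"
          "F ^ n * ?P i j * exp (- ?y) \<le> F ^ n * ?P i j * exp (- s * ?S i j)"
          using P0 by (auto intro!: mult_left_mono simp del: mult_minus_left)
        then show "F ^ n * ?P i j * exp (- ?y) \<le> word_prod d l n i * word_prod2 d w n i j"
          "F ^ n * ?P i j * exp (- ?y) \<le> word_prod d m n j * word_prod2 d w n i j"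
          using words[of n i j] by linarith+
      qed
      also have "\<dots> = min (word_prod d l n i) (word_prod d m n j) * word_prod2 d w n i j"
        using word_prod2_nonneg[of w, OF w] by (simp add: min_mult_distrib_right)
      finally show ?thesis by (simp add: algebra_simps)
    qed
    have "F ^ n * exp (- x) \<le> F ^ n * (exp (- x) * ((1 + x / 2) - real n * (K - 1) / (2 * x)))"
    proof -
      have "real n * (K - 1) / (2 * x) \<le> x\<^sup>2 / (2 * x)"
        using x by (intro divide_right_mono) (auto simp: algebra_simps)
      then have "1 \<le> (1 + x / 2) - real n * (K - 1) / (2 * x)"
        using x(1) by (simp add: power2_eq_square)
      then show ?thesis using F by (intro mult_left_mono) auto
    qed
    also have "\<dots> = (\<Sum>i<d ^ n. \<Sum>j<d ^ n. F ^ n * (exp (- x) * ((1 + x / 2) * ?P i j - ?P i j * (?S i j)\<^sup>2 / (2 * x))))"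
      using word_sum2_moments(2)[OF R1 g0, of n] sum_word_prod2[where f = R and n = n] R1
      by (simp add: K_def sum_subtractf flip: sum_distrib_left sum_divide_distrib)
    also have "\<dots> \<le> (\<Sum>i<d ^ n. \<Sum>j<d ^ n. min (word_prod d l n i) (word_prod d m n j) * word_prod2 d w n i j)"
      by (intro sum_mono pt)
    finally show ?thesis by (simp add: x_def)
  qed simp
  then show ?thesis using that[of K] by (simp add: F_def)
qed

section \<open>Error rates\<close>

lemma overlap_commute:
  assumes "U \<in> carrier_mat d d" "V \<in> carrier_mat d d" "i < d" "j < d"
  shows "overlap V U j i = overlap U V i j"
  using overlap_cscalar_prod(1)[OF assms(2,1,4,3)] overlap_cscalar_prod(2)[OF assms] by simp

lemma op_trace_smult_mult:
  assumes "A \<in> carrier_mat d d" "B \<in> carrier_mat d d"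
  shows "op_trace ((c \<cdot>\<^sub>m A) * B) = c * op_trace (A * B)"
  using assms by (simp add: op_trace_def sum_distrib_left mult_smult_assoc_mat[of _ d d])

lemma op_trace_mix_mult:
  assumes \<sigma>: "\<And>i. i \<in> {1..r} \<Longrightarrow> \<sigma> i \<in> carrier_mat d d" and E: "E \<in> carrier_mat (d ^ n) (d ^ n)"
  shows "op_trace (mix_tensor_pow d r q \<sigma> n * E) =
    (\<Sum>i = 1..r. complex_of_real (q i) * op_trace (tensor_pow (\<sigma> i) n * E))"
proof -
  let ?D = "d ^ n" and ?t = "\<lambda>i. tensor_pow (\<sigma> i) n"
  have t: "?t i \<in> carrier_mat ?D ?D" if "i \<in> {1..r}" for i using \<sigma>[OF that] by simp
  have "op_trace (mix_tensor_pow d r q \<sigma> n * E) =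
      (\<Sum>j<?D. \<Sum>k<?D. \<Sum>i = 1..r. complex_of_real (q i) * (?t i $$ (j, k) * E $$ (k, j)))"
    using E by (simp add: op_trace_def mix_tensor_pow_def scalar_prod_def lessThan_atLeast0
        sum_distrib_right mult.assoc)
  also have "\<dots> = (\<Sum>j<?D. \<Sum>i = 1..r. \<Sum>k<?D. complex_of_real (q i) * (?t i $$ (j, k) * E $$ (k, j)))"
    by (rule sum.cong[OF refl], rule sum.swap)
  also have "\<dots> = (\<Sum>i = 1..r. \<Sum>j<?D. \<Sum>k<?D. complex_of_real (q i) * (?t i $$ (j, k) * E $$ (k, j)))"
    by (rule sum.swap)
  also have "\<dots> = (\<Sum>i = 1..r. complex_of_real (q i) * op_trace (?t i * E))"
  proof (rule sum.cong[OF refl])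
    fix i assume "i \<in> {1..r}"
    from t[OF this] show "(\<Sum>j<?D. \<Sum>k<?D. complex_of_real (q i) * (?t i $$ (j, k) * E $$ (k, j))) =
        complex_of_real (q i) * op_trace (?t i * E)"
      using E by (simp add: op_trace_def scalar_prod_def lessThan_atLeast0 sum_distrib_left)
  qed
  finally show ?thesis .
qed

section \<open>States of rank one are projections\<close>

lemma det2_eq_zero:
  fixes a b c e u v :: "'a :: idom"
  assumes "u \<noteq> 0 \<or> v \<noteq> 0" "a * u + b * v = 0" "c * u + e * v = 0"
  shows "a * e = b * c"
proof -
  have "u * (a * e - b * c) = e * (a * u + b * v) - b * (c * u + e * v)"
    "v * (a * e - b * c) = a * (c * u + e * v) - c * (a * u + b * v)"
    by (simp_all add: algebra_simps)
  then show ?thesis using assms by auto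
qed

text \<open>Two distinct columns are linearly dependent, and a nonzero dependency annihilates both
  rows of the 2 x 2 minor. Equal columns are treated apart because, as a set, they do not form a
  two-element family.\<close>

lemma rank_one_minors:
  fixes A :: "complex mat"
  assumes A: "A \<in> carrier_mat d d" and rank: "vec_space.rank d A = 1"
    and ij: "i < d" "j < d" "k < d" "x < d"
  shows "A $$ (i, j) * A $$ (x, k) = A $$ (i, k) * A $$ (x, j)"
proof (cases "col A j = col A k")
  case True
  then have "A $$ (y, j) = A $$ (y, k)" if "y < d" for y
    using True that A ij by (metis carrier_matD index_col)
  then show ?thesis using ij by simp
next
  case False
  define B where "B = mat_of_cols d [col A j, col A k]"
  have B: "B \<in> carrier_mat d 2"
    using mat_of_cols_carrier(1)[of d "[col A j, col A k]"] by (simp add: B_def numeral_2_eq_2)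
  have cols: "cols B = [col A j, col A k]" using A ij by (simp add: B_def)
  have sub: "set (cols B) \<subseteq> set (cols A)" unfolding cols using A ij by (auto simp: cols_def)
  have card: "card (set (cols B)) = 2" using False by (simp add: cols)
  interpret vec_space "TYPE(complex)" d .
  have "lin_dep (set (cols B))"
    using rank_ge_card_indpt[OF A sub] rank card by linarith
  then obtain v where v: "v \<in> carrier_vec 2" "v \<noteq> 0\<^sub>v 2" "B *\<^sub>v v = 0\<^sub>v d"
    using lin_depE[OF B] False unfolding cols by auto
  have eq: "A $$ (y, j) * v $ 0 + A $$ (y, k) * v $ 1 = 0" if "y < d" for y
  proof -
    have "(B *\<^sub>v v) $ y = A $$ (y, j) * v $ 0 + A $$ (y, k) * v $ 1"
      using that A B v(1) ij by (simp add: scalar_prod_def B_def mat_of_cols_def numeral_2_eq_2)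
    then show ?thesis using v(3) that by simp
  qed
  have "v $ 0 \<noteq> 0 \<or> v $ 1 \<noteq> 0"
    using v(1,2) by (auto simp: vec_eq_iff less_2_cases_iff)
  then show ?thesis using eq[OF ij(1)] eq[OF ij(4)] by (rule det2_eq_zero)
qed

text \<open>Vanishing minors turn \<open>A $$ (i, k) * A $$ (k, j)\<close> into
  \<open>A $$ (i, j) * A $$ (k, k)\<close>. Summing over \<open>k\<close> shows that the square of
  \<open>A\<close> is its trace times \<open>A\<close>.\<close>

lemma rank_one_idempotent:
  fixes A :: "complex mat"
  assumes A: "A \<in> carrier_mat d d" and rank: "vec_space.rank d A = 1" and trace: "op_trace A = 1"
  shows "A * A = A"
proof (rule eq_matI)
  fix i j assume "i < dim_row A" "j < dim_col A"
  then have ij: "i < d" "j < d" using A by auto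
  have "(A * A) $$ (i, j) = (\<Sum>k<d. A $$ (i, k) * A $$ (k, j))"
    using A ij by (simp add: scalar_prod_def lessThan_atLeast0)
  also have "\<dots> = (\<Sum>k<d. A $$ (i, j) * A $$ (k, k))"
    using rank_one_minors[OF A rank] ij by (intro sum.cong) auto
  also have "\<dots> = A $$ (i, j)"
    using trace A by (simp add: op_trace_def flip: sum_distrib_left)
  finally show "(A * A) $$ (i, j) = A $$ (i, j)" .
qed (use A in auto)

lemma of_spectrum_idempotent:
  assumes U: "unitary_op d U" and idem: "of_spectrum d U l * of_spectrum d U l = of_spectrum d U l"
    and k: "k < d"
  shows "l k = 0 \<or> l k = 1"
proof -
  note u = unitary_opD[OF U]
  have "of_spectrum d U (\<lambda>i. l i * l i) = of_spectrum d U l"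
    using idem by (simp add: of_spectrum_mult[OF U])
  then have "complex_of_real (l k * l k) \<cdot>\<^sub>v col U k = complex_of_real (l k) \<cdot>\<^sub>v col U k"
    using of_spectrum_col[OF U k] by metis
  then have *: "(complex_of_real (l k * l k) \<cdot>\<^sub>v col U k) $ x = (complex_of_real (l k) \<cdot>\<^sub>v col U k) $ x" for x
    by simp
  have eq: "complex_of_real (l k * l k) * U $$ (x, k) = complex_of_real (l k) * U $$ (x, k)" if "x < d" for x
    using *[of x] that u(1) k by simp
  have "(\<Sum>x<d. cnj (U $$ (x, k)) * U $$ (x, k)) = 1"
    using u k index_mat_adjoint_mult[OF u(1) u(1) k k] by simp
  then obtain x where "x < d" "U $$ (x, k) \<noteq> 0"
    by (metis (no_types, lifting) lessThan_iff mult_zero_right sum.neutral zero_neq_one)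
  with eq have "complex_of_real (l k * l k) = complex_of_real (l k)" by auto
  then show ?thesis by (simp only: of_real_eq_iff) simp
qed

section \<open>From bounds at each n to exponential rates\<close>

lemma elog_pos: "0 < x \<Longrightarrow> elog b x = ereal (log b x)"
  by (simp add: elog_def)

lemma elog_mono:
  assumes "1 < b" "x \<le> y"
  shows "elog b x \<le> elog b y"
  using assms by (auto simp: elog_def)

text \<open>The constant \<open>K\<close> disappears after division by \<open>n\<close>. For
  \<open>x = 0\<close> the bound forces \<open>e n \<le> 0\<close> at every positive
  \<open>n\<close>, so the rate is eventually minus infinity.\<close>

lemma limsup_rate_le:
  assumes b: "1 < b" and K: "0 < K" and x: "0 \<le> x"
    and e: "\<And>n. 0 < n \<Longrightarrow> e n \<le> K * x ^ n"
  shows "limsup (\<lambda>n. ereal (1 / real n) * elog b (e n)) \<le> elog b x"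
proof (cases "x = 0")
  case True
  have "ereal (1 / real n) * elog b (e n) = - \<infinity>" if "0 < n" for n
    using e[OF that] that True by (simp add: elog_def power_0_left)
  then have "eventually (\<lambda>n. ereal (1 / real n) * elog b (e n) \<le> - \<infinity>) sequentially"
    by (intro eventually_sequentiallyI[of 1]) auto
  then have "limsup (\<lambda>n. ereal (1 / real n) * elog b (e n)) \<le> - \<infinity>" by (rule Limsup_bounded)
  then show ?thesis by simp
next
  case False
  then have x: "0 < x" using x by simp
  define B where "B n = log b K / real n + log b x" for n
  have "ereal (1 / real n) * elog b (e n) \<le> ereal (B n)" if n: "0 < n" for n
  proof -
    have "elog b (e n) \<le> elog b (K * x ^ n)" using b e[OF n] by (rule elog_mono)
    also have "\<dots> = ereal (log b K + real n * log b x)"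
      using b K x by (simp add: elog_pos log_mult log_nat_power)
    finally have "ereal (1 / real n) * elog b (e n) \<le> ereal (1 / real n) * ereal (log b K + real n * log b x)"
      by (intro ereal_mult_left_mono) auto
    then show ?thesis using n by (simp add: B_def field_simps)
  qed
  then have "limsup (\<lambda>n. ereal (1 / real n) * elog b (e n)) \<le> limsup (\<lambda>n. ereal (B n))"
    by (intro Limsup_mono eventually_sequentiallyI[of 1]) auto
  also have "B \<longlonglongrightarrow> 0 + log b x"
    unfolding B_def[abs_def] by (intro tendsto_add lim_const_over_n tendsto_const)
  then have "limsup (\<lambda>n. ereal (B n)) = elog b x"
    using x by (intro lim_imp_Limsup) (auto simp: elog_pos)
  finally show ?thesis .
qed

text \<open>The subexponential factor contributes only \<open>sqrt (K / real n) / ln b\<close> to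
  the rate, which tends to 0.\<close>

lemma liminf_rate_ge:
  assumes b: "1 < b" and c: "0 < c" and x: "0 < x"
    and e: "\<And>n. c * (x ^ n * exp (- sqrt (real n * K))) \<le> e n"
  shows "elog b x \<le> liminf (\<lambda>n. ereal (1 / real n) * elog b (e n))"
proof -
  define B where "B n = log b c / real n + log b x - sqrt (K / real n) / ln b" for n
  have "ereal (B n) \<le> ereal (1 / real n) * elog b (e n)" if n: "0 < n" for n
  proof -
    have "log b (exp (- sqrt (real n * K))) = - sqrt (real n * K) / ln b" by (simp add: log_def)
    then have "elog b (c * (x ^ n * exp (- sqrt (real n * K)))) =
        ereal (log b c + (real n * log b x - sqrt (real n * K) / ln b))"
      using b c x by (simp add: elog_pos log_mult log_nat_power)
    moreover have "elog b (c * (x ^ n * exp (- sqrt (real n * K)))) \<le> elog b (e n)"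
      using b e by (rule elog_mono)
    ultimately have "ereal (1 / real n) * ereal (log b c + (real n * log b x - sqrt (real n * K) / ln b)) \<le>
        ereal (1 / real n) * elog b (e n)"
      by (intro ereal_mult_left_mono) auto
    moreover have "sqrt (real n * K) / real n = sqrt (K / real n)"
      using n by (simp add: real_sqrt_mult real_sqrt_divide field_simps)
    moreover have "1 / real n * (log b c + (real n * log b x - sqrt (real n * K) / ln b)) =
        log b c / real n + log b x - (sqrt (real n * K) / real n) / ln b"
      using n by (simp add: add_divide_distrib diff_divide_distrib)
    ultimately show ?thesis by (simp add: B_def)
  qed
  then have "liminf (\<lambda>n. ereal (B n)) \<le> liminf (\<lambda>n. ereal (1 / real n) * elog b (e n))"
    by (intro Liminf_mono eventually_sequentiallyI[of 1]) auto
  moreover have "B \<longlonglongrightarrow> 0 + log b x - sqrt 0 / ln b"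
    unfolding B_def[abs_def] using b
    by (intro tendsto_diff tendsto_add tendsto_divide tendsto_real_sqrt lim_const_over_n tendsto_const) auto
  then have "liminf (\<lambda>n. ereal (B n)) = elog b x"
    using x by (intro lim_imp_Liminf) (auto simp: elog_pos)
  ultimately show ?thesis by simp
qed

section \<open>Discriminating a state from a mixture\<close>

text \<open>Fixes spectral decompositions of all states once, so that the rest works with
  eigenvalues and overlaps only.\<close>

locale mixture_discrimination =
  fixes d r :: nat and p :: real and q :: "nat \<Rightarrow> real"
    and U :: "complex mat" and l :: "nat \<Rightarrow> real"
    and V :: "nat \<Rightarrow> complex mat" and m :: "nat \<Rightarrow> nat \<Rightarrow> real" and \<sigma> :: "nat \<Rightarrow> complex mat"
  assumes p: "0 < p" "p < 1"
    and q: "\<And>i. i \<in> {1..r} \<Longrightarrow> 0 < q i" "(\<Sum>i = 1..r. q i) = 1"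
    and U: "unitary_op d U" and l: "\<And>k. 0 \<le> l k"
    and V: "\<And>i. i \<in> {1..r} \<Longrightarrow> unitary_op d (V i)"
    and m: "\<And>i k. i \<in> {1..r} \<Longrightarrow> 0 \<le> m i k" "\<And>i. i \<in> {1..r} \<Longrightarrow> (\<Sum>k<d. m i k) = 1"
    and \<sigma>: "\<And>i. i \<in> {1..r} \<Longrightarrow> \<sigma> i = of_spectrum d (V i) (m i)"
begin

abbreviation \<rho> :: "complex mat" where "\<rho> \<equiv> of_spectrum d U l"

abbreviation w :: "nat \<Rightarrow> nat \<Rightarrow> nat \<Rightarrow> real" where "w i \<equiv> overlap U (V i)"

definition err :: "nat \<Rightarrow> real" where
  "err n = opt_error (d ^ n) (complex_of_real p \<cdot>\<^sub>m tensor_pow \<rho> n)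
    (complex_of_real (1 - p) \<cdot>\<^sub>m mix_tensor_pow d r q \<sigma> n)"

definition test_error :: "nat \<Rightarrow> complex mat \<Rightarrow> real" where
  "test_error n E = p * Re (op_trace (tensor_pow \<rho> n * (1\<^sub>m (d ^ n) - E))) +
    (1 - p) * (\<Sum>i = 1..r. q i * Re (op_trace (tensor_pow (\<sigma> i) n * E)))"

text \<open>The Nussbaum-Szkola error of the pair \<rho>, \<sigma>_i for \<open>n\<close> copies, in
  word coordinates (see \<open>classical_error_pow\<close>).\<close>

definition pair_error :: "nat \<Rightarrow> nat \<Rightarrow> real" where
  "pair_error n i = (\<Sum>j<d ^ n. \<Sum>k<d ^ n.
    min (word_prod d l n j) (word_prod d (m i) n k) * word_prod2 d (w i) n j k)"

lemma \<rho>_pow: "tensor_pow \<rho> n = of_spectrum (d ^ n) (tensor_pow U n) (word_prod d l n)"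
  by (rule tensor_pow_of_spectrum[OF U])

lemma \<sigma>_pow:
  assumes "i \<in> {1..r}"
  shows "tensor_pow (\<sigma> i) n = of_spectrum (d ^ n) (tensor_pow (V i) n) (word_prod d (m i) n)"
  unfolding \<sigma>[OF assms] by (rule tensor_pow_of_spectrum[OF V[OF assms]])

lemma classical_error_pow:
  assumes "i \<in> {1..r}"
  shows "classical_error (d ^ n) (tensor_pow U n) (word_prod d l n) (tensor_pow (V i) n) (word_prod d (m i) n) =
    pair_error n i"
  unfolding classical_error_def pair_error_def
  using unitary_opD(1)[OF U] unitary_opD(1)[OF V[OF assms]] by (simp add: overlap_tensor_pow)

lemma err_eq: "err n = Inf {test_error n E | E. psd (d ^ n) E \<and> psd (d ^ n) (1\<^sub>m (d ^ n) - E)}"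
proof -
  have "Re (op_trace (complex_of_real p \<cdot>\<^sub>m tensor_pow \<rho> n * (1\<^sub>m (d ^ n) - E)) +
      op_trace (complex_of_real (1 - p) \<cdot>\<^sub>m mix_tensor_pow d r q \<sigma> n * E)) = test_error n E"
    if E: "psd (d ^ n) E" for E
  proof -
    have E: "E \<in> carrier_mat (d ^ n) (d ^ n)" "1\<^sub>m (d ^ n) - E \<in> carrier_mat (d ^ n) (d ^ n)"
      using E by (auto simp: psd_def intro: minus_carrier_mat)
    have \<rho>: "tensor_pow \<rho> n \<in> carrier_mat (d ^ n) (d ^ n)" using U by simp
    have \<sigma>c: "\<sigma> i \<in> carrier_mat d d" if "i \<in> {1..r}" for i using \<sigma>[OF that] V[OF that] by simp
    have mix: "mix_tensor_pow d r q \<sigma> n \<in> carrier_mat (d ^ n) (d ^ n)" by (simp add: mix_tensor_pow_def)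
    have "op_trace (mix_tensor_pow d r q \<sigma> n * E) =
        (\<Sum>i = 1..r. complex_of_real (q i) * op_trace (tensor_pow (\<sigma> i) n * E))"
      by (rule op_trace_mix_mult[OF \<sigma>c E(1)])
    then show ?thesis
      unfolding op_trace_smult_mult[OF \<rho> E(2)] op_trace_smult_mult[OF mix E(1)] test_error_def
      by simp
  qed
  then have "{Re (op_trace (complex_of_real p \<cdot>\<^sub>m tensor_pow \<rho> n * (1\<^sub>m (d ^ n) - E)) +
      op_trace (complex_of_real (1 - p) \<cdot>\<^sub>m mix_tensor_pow d r q \<sigma> n * E)) | E.
      psd (d ^ n) E \<and> psd (d ^ n) (1\<^sub>m (d ^ n) - E)} =
    {test_error n E | E. psd (d ^ n) E \<and> psd (d ^ n) (1\<^sub>m (d ^ n) - E)}"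
    by (intro Collect_cong) metis
  then show ?thesis unfolding err_def opt_error_def by simp
qed

lemma trace_nonneg:
  assumes "psd (d ^ n) E"
  shows "0 \<le> Re (op_trace (tensor_pow \<rho> n * E))"
    and "i \<in> {1..r} \<Longrightarrow> 0 \<le> Re (op_trace (tensor_pow (\<sigma> i) n * E))"
  using op_trace_psd_of_spectrum_nonneg[OF unitary_op_tensor_pow[OF U] word_prod_nonneg[of l, OF l] assms]
    op_trace_psd_of_spectrum_nonneg[OF unitary_op_tensor_pow[OF V] word_prod_nonneg[of "m i", OF m(1)] assms]
  by (simp_all add: \<rho>_pow \<sigma>_pow)

lemma err_le:
  assumes "psd (d ^ n) E" "psd (d ^ n) (1\<^sub>m (d ^ n) - E)"
  shows "err n \<le> test_error n E"
  unfolding err_eq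
proof (rule cInf_lower)
  show "bdd_below {test_error n E | E. psd (d ^ n) E \<and> psd (d ^ n) (1\<^sub>m (d ^ n) - E)}"
    using p q trace_nonneg
    by (intro bdd_belowI[of _ 0]) (auto simp: test_error_def less_imp_le intro!: sum_nonneg add_nonneg_nonneg mult_nonneg_nonneg)
qed (use assms in auto)

lemma err_ge_pair_error:
  assumes i: "i \<in> {1..r}"
  shows "min p ((1 - p) * q i) / 2 * pair_error n i \<le> err n"
  unfolding err_eq
proof (rule cInf_greatest)
  note Un = unitary_op_tensor_pow[OF U, of n]
  have "psd (d ^ n) (1\<^sub>m (d ^ n))" "psd (d ^ n) (1\<^sub>m (d ^ n) - 1\<^sub>m (d ^ n))"
    using psd_of_spectrum[OF Un, of "\<lambda>_. 1"] psd_of_spectrum[OF Un, of "\<lambda>_. 0"]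
      of_spectrum_diff[OF Un, of "\<lambda>_. 1" "\<lambda>_. 1"]
    by (simp_all add: of_spectrum_one[OF Un])
  then show "{test_error n E | E. psd (d ^ n) E \<and> psd (d ^ n) (1\<^sub>m (d ^ n) - E)} \<noteq> {}" by blast
next
  fix x assume "x \<in> {test_error n E | E. psd (d ^ n) E \<and> psd (d ^ n) (1\<^sub>m (d ^ n) - E)}"
  then obtain E where x: "x = test_error n E" and E: "psd (d ^ n) E" "psd (d ^ n) (1\<^sub>m (d ^ n) - E)" by auto
  define c where "c = min p ((1 - p) * q i)"
  have c: "0 \<le> c" "c \<le> p" "c \<le> (1 - p) * q i" using p q(1)[OF i] by (auto simp: c_def)
  let ?a = "Re (op_trace (tensor_pow \<rho> n * (1\<^sub>m (d ^ n) - E)))"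
    and ?b = "\<lambda>i. Re (op_trace (tensor_pow (\<sigma> i) n * E))"
  have "pair_error n i / 2 \<le> ?a + ?b i"
    using test_error_ge[where l = "word_prod d l n" and m = "word_prod d (m i) n",
        OF unitary_op_tensor_pow[OF U] unitary_op_tensor_pow[OF V[OF i]]
        word_prod_nonneg[of l, OF l] word_prod_nonneg[of "m i", OF m(1)[OF i]] E]
    by (simp add: classical_error_pow[OF i] \<rho>_pow \<sigma>_pow[OF i])
  then have "c * (pair_error n i / 2) \<le> c * (?a + ?b i)" using c(1) by (rule mult_left_mono)
  also have "\<dots> = c * ?a + c * ?b i" by (rule distrib_left)
  also have "\<dots> \<le> p * ?a + (1 - p) * q i * ?b i"
    using c trace_nonneg(1)[OF E(2)] trace_nonneg(2)[OF E(1) i] by (intro add_mono mult_right_mono)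
  also have "q i * ?b i \<le> (\<Sum>i = 1..r. q i * ?b i)"
    using i q(1) trace_nonneg(2)[OF E(1)] by (intro member_le_sum) (auto simp: less_imp_le)
  then have "p * ?a + (1 - p) * q i * ?b i \<le> test_error n E"
    using p unfolding test_error_def mult.assoc by (intro add_left_mono mult_left_mono) auto
  finally show "min p ((1 - p) * q i) / 2 * pair_error n i \<le> x" by (simp add: x c_def)
qed

text \<open>Bounds the weights \<open>p\<close> and \<open>1 - p\<close> by 1. The saturation cost
  stays \<open>1 / t\<close> for the whole mixture because the states have trace 1 and the
  \<open>q i\<close> sum to 1; \<open>t\<close> is left free for balancing.\<close>

lemma err_le_pair_error:
  assumes t: "0 < t"
  shows "err n \<le> t * (\<Sum>i = 1..r. pair_error n i) + (\<Sum>i = 1..r. q i * pair_error n i) + 1 / t"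
proof -
  have m1: "(\<Sum>j<d ^ n. word_prod d (m i) n j) = 1" if "i \<in> {1..r}" for i
    by (simp add: sum_word_prod m(2)[OF that])
  obtain E where E: "psd (d ^ n) E" "psd (d ^ n) (1\<^sub>m (d ^ n) - E)"
    and E1: "Re (op_trace (tensor_pow \<rho> n * (1\<^sub>m (d ^ n) - E))) \<le> t * (\<Sum>i = 1..r. pair_error n i)"
    and E2: "\<And>i. i \<in> {1..r} \<Longrightarrow> Re (op_trace (tensor_pow (\<sigma> i) n * E)) \<le> pair_error n i + 1 / t"
  proof (rule test_error_le[of "{1..r}" "d ^ n" "tensor_pow U n" "\<lambda>i. tensor_pow (V i) n" "word_prod d l n"
      "\<lambda>i. word_prod d (m i) n" t])
    fix E
    assume "psd (d ^ n) E" "psd (d ^ n) (1\<^sub>m (d ^ n) - E)"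
      and E1: "Re (op_trace (of_spectrum (d ^ n) (tensor_pow U n) (word_prod d l n) * (1\<^sub>m (d ^ n) - E))) \<le>
        t * (\<Sum>i = 1..r. classical_error (d ^ n) (tensor_pow U n) (word_prod d l n) (tensor_pow (V i) n) (word_prod d (m i) n))"
      and E2: "\<And>i. i \<in> {1..r} \<Longrightarrow> Re (op_trace (of_spectrum (d ^ n) (tensor_pow (V i) n) (word_prod d (m i) n) * E)) \<le>
        classical_error (d ^ n) (tensor_pow U n) (word_prod d l n) (tensor_pow (V i) n) (word_prod d (m i) n) +
        (\<Sum>j<d ^ n. word_prod d (m i) n j) / t"
    moreover have "Re (op_trace (tensor_pow \<rho> n * (1\<^sub>m (d ^ n) - E))) \<le> t * (\<Sum>i = 1..r. pair_error n i)"
      using E1 by (simp add: \<rho>_pow classical_error_pow)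
    moreover have "Re (op_trace (tensor_pow (\<sigma> i) n * E)) \<le> pair_error n i + 1 / t" if "i \<in> {1..r}" for i
      using E2[OF that] by (simp only: \<sigma>_pow[OF that] classical_error_pow[OF that] m1[OF that])
    ultimately show thesis using that by blast
  qed (use U V l m t in \<open>auto intro: unitary_op_tensor_pow word_prod_nonneg\<close>)
  let ?a = "Re (op_trace (tensor_pow \<rho> n * (1\<^sub>m (d ^ n) - E)))"
    and ?b = "\<lambda>i. Re (op_trace (tensor_pow (\<sigma> i) n * E))"
  have a: "0 \<le> ?a" by (rule trace_nonneg(1)[OF E(2)])
  have b: "0 \<le> (\<Sum>i = 1..r. q i * ?b i)"
    using q(1) trace_nonneg(2)[OF E(1)] by (intro sum_nonneg mult_nonneg_nonneg) (auto simp: less_imp_le)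
  have "err n \<le> test_error n E" by (rule err_le[OF E])
  also have "\<dots> \<le> ?a + (\<Sum>i = 1..r. q i * ?b i)"
    unfolding test_error_def using p a b by (intro add_mono mult_left_le_one_le) auto
  also have "(\<Sum>i = 1..r. q i * ?b i) \<le> (\<Sum>i = 1..r. q i * (pair_error n i + 1 / t))"
    using q(1) E2 by (intro sum_mono mult_left_mono) (auto simp: less_imp_le)
  also have "\<dots> = (\<Sum>i = 1..r. q i * pair_error n i) + 1 / t"
    by (simp add: distrib_left sum.distrib q(2) del: One_nat_def flip: sum_divide_distrib)
  finally show ?thesis using E1 by simp
qed

lemma chernoff_trace:
  assumes i: "i \<in> {1..r}"
  shows "Re (op_trace (mat_powr d \<rho> s * mat_powr d (\<sigma> i) (1 - s))) = chernoff_sum d l (m i) (w i) s"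
  unfolding \<sigma>[OF i] mat_powr_of_spectrum[OF U] mat_powr_of_spectrum[OF V[OF i]]
    op_trace_of_spectrum_of_spectrum[OF U V[OF i]] chernoff_sum_def by simp

text \<open>The number whose negative logarithm is the Chernoff divergence of \<rho> and \<sigma>_i;
  orthogonal supports become the value 0 and no extended reals are involved.\<close>

definition chernoff_inf :: "nat \<Rightarrow> real" where
  "chernoff_inf i = (INF s\<in>{0..1}. chernoff_sum d l (m i) (w i) s)"

lemma chernoff_div_eq: "i \<in> {1..r} \<Longrightarrow> chernoff_div b d \<rho> (\<sigma> i) = - elog b (chernoff_inf i)"
  by (simp add: chernoff_div_def chernoff_trace chernoff_inf_def)

lemma chernoff_inf_attained:
  assumes i: "i \<in> {1..r}"
  obtains s where "0 \<le> s" "s \<le> 1" "chernoff_inf i = chernoff_sum d l (m i) (w i) s"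
    "\<And>t. 0 \<le> t \<Longrightarrow> t \<le> 1 \<Longrightarrow> chernoff_sum d l (m i) (w i) s \<le> chernoff_sum d l (m i) (w i) t"
proof -
  obtain s where s: "0 \<le> s" "s \<le> 1"
    "\<And>t. 0 \<le> t \<Longrightarrow> t \<le> 1 \<Longrightarrow> chernoff_sum d l (m i) (w i) s \<le> chernoff_sum d l (m i) (w i) t"
    using chernoff_sum_attains_min[of l "m i", OF l m(1)[OF i]] by blast
  moreover have "chernoff_inf i = chernoff_sum d l (m i) (w i) s"
    unfolding chernoff_inf_def using s by (intro cInf_eq_minimum) auto
  ultimately show ?thesis using that by blast
qed

lemma chernoff_inf_bounds:
  assumes i: "i \<in> {1..r}"
  shows "0 \<le> chernoff_inf i" "chernoff_inf i \<le> 1" "pair_error n i \<le> chernoff_inf i ^ n"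
proof -
  obtain s where s: "0 \<le> s" "s \<le> 1" "chernoff_inf i = chernoff_sum d l (m i) (w i) s"
    and min: "\<And>t. 0 \<le> t \<Longrightarrow> t \<le> 1 \<Longrightarrow> chernoff_sum d l (m i) (w i) s \<le> chernoff_sum d l (m i) (w i) t"
    using chernoff_inf_attained[OF i] by blast
  show "0 \<le> chernoff_inf i" unfolding s(3) by (intro chernoff_sum_nonneg) simp
  show "pair_error n i \<le> chernoff_inf i ^ n"
    unfolding s(3) pair_error_def using l m(1)[OF i] s by (intro sum_min_le_chernoff_sum) auto
  \<comment> \<open>At \<open>s = 0\<close> the power of \<rho> is a support projection, and the
    remaining weights have total mass 1 by \<open>overlap_sum\<close>.\<close>
  have "chernoff_inf i \<le> chernoff_sum d l (m i) (w i) 0" unfolding s(3) by (rule min) auto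
  also have "\<dots> \<le> (\<Sum>a<d. \<Sum>b<d. m i b * w i a b)"
  proof -
    have "l a powr 0 * m i b powr (1 - 0) \<le> m i b" for a b
      using m(1)[OF i, of b] by (cases "l a = 0") auto
    then show ?thesis unfolding chernoff_sum_def by (intro sum_mono mult_right_mono) auto
  qed
  also have "\<dots> = (\<Sum>b<d. \<Sum>a<d. m i b * w i a b)" by (rule sum.swap)
  also have "\<dots> = 1" using m(2)[OF i] overlap_sum[OF U V[OF i]] by (simp flip: sum_distrib_left)
  finally show "chernoff_inf i \<le> 1" .
qed

text \<open>Valid for each component separately; the sharpest choice is the largest
  \<open>chernoff_inf\<close>. If it vanishes, the left side is minus infinity.\<close>

lemma liminf_ge_chernoff_inf:
  assumes b: "1 < b" and i: "i \<in> {1..r}"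
  shows "elog b (chernoff_inf i) \<le> liminf (\<lambda>n. ereal (1 / real n) * elog b (err n))"
proof (cases "chernoff_inf i \<le> 0")
  case True
  then show ?thesis by (simp add: elog_def)
next
  case False
  obtain s where s: "0 \<le> s" "s \<le> 1" "chernoff_inf i = chernoff_sum d l (m i) (w i) s"
    and min: "\<And>t. 0 \<le> t \<Longrightarrow> t \<le> 1 \<Longrightarrow> chernoff_sum d l (m i) (w i) s \<le> chernoff_sum d l (m i) (w i) t"
    using chernoff_inf_attained[OF i] by blast
  obtain K where K: "\<And>n. chernoff_inf i ^ n * exp (- sqrt (real n * K)) \<le> pair_error n i"
    using sum_min_ge_chernoff_sum[of l "m i" "w i" s d, OF l m(1)[OF i] overlap_nonneg s(1,2) min] False
    unfolding s(3) pair_error_def by fastforce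
  define c where "c = min p ((1 - p) * q i) / 2"
  have c: "0 < c" using p q(1)[OF i] by (simp add: c_def)
  show ?thesis
  proof (rule liminf_rate_ge[OF b c])
    fix n
    have "c * (chernoff_inf i ^ n * exp (- sqrt (real n * K))) \<le> c * pair_error n i"
      using K c by (intro mult_left_mono) auto
    also have "\<dots> \<le> err n" using err_ge_pair_error[OF i, of n] by (simp only: c_def)
    finally show "c * (chernoff_inf i ^ n * exp (- sqrt (real n * K))) \<le> err n" .
  qed (use False in simp)
qed

text \<open>The constant \<open>real r + 2\<close> collects \<open>r\<close> from the error of
  \<rho>, 1 from the averaged pair errors and 1 from \<open>1 / t\<close>.\<close>

lemma limsup_le_half:
  assumes b: "1 < b" and x: "0 \<le> x" "x \<le> 1" and max: "\<And>i. i \<in> {1..r} \<Longrightarrow> chernoff_inf i \<le> x"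
  shows "limsup (\<lambda>n. ereal (1 / real n) * elog b (err n)) \<le> elog b (sqrt x)"
proof (rule limsup_rate_le[OF b, of "real r + 2"])
  fix n :: nat assume n: "0 < n"
  have N: "pair_error n i \<le> x ^ n" if "i \<in> {1..r}" for i
    using chernoff_inf_bounds[OF that] max[OF that] by (meson order_trans power_mono)
  have N1: "(\<Sum>i = 1..r. pair_error n i) \<le> real r * x ^ n"
    using sum_mono[of "{1..r}" "pair_error n" "\<lambda>_. x ^ n", OF N] by simp
  have N2: "(\<Sum>i = 1..r. q i * pair_error n i) \<le> x ^ n"
  proof -
    have "(\<Sum>i = 1..r. q i * pair_error n i) \<le> (\<Sum>i = 1..r. q i * x ^ n)"
      using N q(1) by (intro sum_mono mult_left_mono) (auto simp: less_imp_le)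
    then show ?thesis by (simp add: q(2) del: One_nat_def flip: sum_distrib_right)
  qed
  have E: "err n \<le> t * (real r * x ^ n) + x ^ n + 1 / t" if "0 < t" for t
  proof -
    have "t * (\<Sum>i = 1..r. pair_error n i) \<le> t * (real r * x ^ n)" using that N1 by simp
    then show ?thesis using err_le_pair_error[OF that, of n] N2 by linarith
  qed
  show "err n \<le> (real r + 2) * sqrt x ^ n"
  proof (cases "x = 0")
    case True
    have "err n \<le> 0"
    proof (rule ccontr)
      assume "\<not> err n \<le> 0"
      \<comment> \<open>With \<open>x = 0\<close> the bound is \<open>1 / t\<close> for every
        \<open>t\<close>; this choice of \<open>t\<close> would give
        \<open>err n \<le> err n / 2\<close>.\<close>
      then show False using E[of "2 / err n"] True n by (simp add: power_0_left)
    qed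
    then show ?thesis using True n by (simp add: power_0_left)
  next
    case False
    \<comment> \<open>Taking \<open>t = 1 / y\<close> balances \<open>t * x ^ n\<close> against
      \<open>1 / t\<close>: both become multiples of \<open>y\<close>. The middle term is
      \<open>y * y\<close>, absorbed because \<open>x \<le> 1\<close>.\<close>
    define y where "y = sqrt x ^ n"
    have y: "0 < y" "y \<le> 1" "y * y = x ^ n"
      using False x by (auto simp: y_def power_le_one simp flip: power_mult_distrib)
    have "y * y \<le> y" using y(1,2) by (simp add: mult_left_le)
    moreover have "1 / y * (real r * x ^ n) = real r * y"
      using y(1) by (simp add: y(3)[symmetric])
    ultimately have "err n \<le> real r * y + y + y"
      using E[of "1 / y"] y(1) unfolding y(3) by simp
    then show ?thesis by (simp add: y_def[symmetric] algebra_simps)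
  qed
qed (use x in auto)

text \<open>The projection \<open>tensor_pow \<rho> n\<close> used as a test never rejects \<rho>,
  so no balancing is lost. Its other error for \<sigma>_i is the \<open>n\<close>-th power of the
  trace of \<sigma>_i \<rho>. That trace is at most every Chernoff trace, since the eigenvalues of
  \<rho> are 0 or 1 and those of \<sigma>_i satisfy
  \<open>m i a \<le> m i a powr (1 - s)\<close>.\<close>

lemma limsup_le_pure:
  assumes b: "1 < b" and x: "0 \<le> x" and max: "\<And>i. i \<in> {1..r} \<Longrightarrow> chernoff_inf i \<le> x"
    and idem: "\<rho> * \<rho> = \<rho>"
  shows "limsup (\<lambda>n. ereal (1 / real n) * elog b (err n)) \<le> elog b x"
proof (rule limsup_rate_le[OF b, of 1])
  fix n :: nat
  let ?D = "d ^ n" and ?l = "word_prod d l n" and ?U = "tensor_pow U n"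
  note Un = unitary_op_tensor_pow[OF U, of n]
  have l01: "l k = 0 \<or> l k = 1" if "k < d" for k
    using of_spectrum_idempotent[OF U idem that] .
  have "word_prod d l n k = 0 \<or> word_prod d l n k = 1" if "k < d ^ n" for k n
    using that
  proof (induction n arbitrary: k)
    case (Suc n)
    then have k: "k < d * d ^ n" by simp
    show ?case using l01[OF div_mod_less(1)[OF k]] Suc.IH[OF div_mod_less(2)[OF k]] by auto
  qed simp
  note ln01 = this[of _ n]
  have E: "psd ?D (tensor_pow \<rho> n)"
    unfolding \<rho>_pow by (rule psd_of_spectrum[OF Un]) (rule word_prod_nonneg, rule l)
  have E1: "1\<^sub>m ?D - tensor_pow \<rho> n = of_spectrum ?D ?U (\<lambda>k. 1 - ?l k)"
    unfolding \<rho>_pow of_spectrum_one[OF Un, symmetric] of_spectrum_diff[OF Un] ..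
  have E': "psd ?D (1\<^sub>m ?D - tensor_pow \<rho> n)"
    unfolding E1 using ln01 by (intro psd_of_spectrum[OF Un]) fastforce
  have tr1: "op_trace (tensor_pow \<rho> n * (1\<^sub>m ?D - tensor_pow \<rho> n)) = 0"
    unfolding E1 unfolding \<rho>_pow of_spectrum_mult[OF Un] op_trace_of_spectrum[OF Un]
    using ln01 by (auto intro!: sum.neutral)
  have tr2: "Re (op_trace (tensor_pow (\<sigma> i) n * tensor_pow \<rho> n)) \<le> x ^ n" if i: "i \<in> {1..r}" for i
  proof -
    note Vn = unitary_op_tensor_pow[OF V[OF i], of n]
    note u = unitary_opD(1)[OF U] and v = unitary_opD(1)[OF V[OF i]]
    have "Re (op_trace (tensor_pow (\<sigma> i) n * tensor_pow \<rho> n)) =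
        (\<Sum>j<?D. \<Sum>k<?D. word_prod d (m i) n j * ?l k * overlap (tensor_pow (V i) n) ?U j k)"
      unfolding \<sigma>_pow[OF i] \<rho>_pow op_trace_of_spectrum_of_spectrum[OF Vn Un] by simp
    also have "\<dots> = (\<Sum>j<?D. \<Sum>k<?D. word_prod2 d (\<lambda>a b. m i a * l b * overlap (V i) U a b) n j k)"
      by (simp add: word_prod2_split overlap_tensor_pow[OF v u])
    also have "\<dots> = (\<Sum>a<d. \<Sum>b<d. m i a * l b * overlap (V i) U a b) ^ n"
      by (rule sum_word_prod2)
    also have "(\<Sum>a<d. \<Sum>b<d. m i a * l b * overlap (V i) U a b) = (\<Sum>b<d. \<Sum>a<d. m i a * l b * overlap (V i) U a b)"
      by (rule sum.swap)
    also have "\<dots> = (\<Sum>b<d. \<Sum>a<d. l b * m i a * w i b a)"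
      by (simp add: overlap_commute[OF u v] mult.commute)
    also have "\<dots> ^ n \<le> chernoff_inf i ^ n"
    proof (rule power_mono)
      show "0 \<le> (\<Sum>b<d. \<Sum>a<d. l b * m i a * w i b a)"
        using l m(1)[OF i] by (intro sum_nonneg mult_nonneg_nonneg) auto
      obtain s where s: "0 \<le> s" "s \<le> 1" "chernoff_inf i = chernoff_sum d l (m i) (w i) s"
        using chernoff_inf_attained[OF i] by blast
      have "l b * m i a * w i b a \<le> l b powr s * m i a powr (1 - s) * w i b a" if "a < d" "b < d" for a b
      proof -
        have "m i a \<le> (\<Sum>a<d. m i a)" using that m(1)[OF i] by (intro member_le_sum) auto
        then have m1: "m i a \<le> 1" by (simp add: m(2)[OF i])
        have "m i a \<le> m i a powr (1 - s)"
        proof (cases "m i a = 0")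
          case False
          then have "m i a powr 1 \<le> m i a powr (1 - s)"
            using m1 m(1)[OF i, of a] s by (intro powr_mono') auto
          then show ?thesis using m(1)[OF i, of a] by simp
        qed simp
        then show ?thesis using l01[OF that(2)] by (auto intro!: mult_right_mono)
      qed
      then show "(\<Sum>b<d. \<Sum>a<d. l b * m i a * w i b a) \<le> chernoff_inf i"
        unfolding s(3) chernoff_sum_def by (intro sum_mono) auto
    qed
    also have "\<dots> \<le> x ^ n"
      using chernoff_inf_bounds(1)[OF i] max[OF i] by (intro power_mono) auto
    finally show ?thesis .
  qed
  have "(\<Sum>i = 1..r. q i * Re (op_trace (tensor_pow (\<sigma> i) n * tensor_pow \<rho> n))) \<le> (\<Sum>i = 1..r. q i * x ^ n)"
    using tr2 q(1) by (intro sum_mono mult_left_mono) (auto simp: less_imp_le)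
  also have "\<dots> = x ^ n" by (simp add: q(2) del: One_nat_def flip: sum_distrib_right)
  finally have "(1 - p) * (\<Sum>i = 1..r. q i * Re (op_trace (tensor_pow (\<sigma> i) n * tensor_pow \<rho> n))) \<le> (1 - p) * x ^ n"
    using p by (intro mult_left_mono) auto
  also have "\<dots> \<le> x ^ n" using p x by (simp add: mult_left_le_one_le)
  finally show "err n \<le> 1 * x ^ n"
    using err_le[OF E E'] by (simp add: test_error_def tr1)
qed (use x in auto)

end

theorem theorem4p6:
  fixes b p :: real and d r :: nat
    and \<rho> :: "complex mat" and \<sigma> :: "nat \<Rightarrow> complex mat" and q :: "nat \<Rightarrow> real"
  assumes "1 < b"
    and "density_op d \<rho>"
    and "\<forall>i\<in>{1..r}. density_op d (\<sigma> i)"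
    and "0 < p" and "p < 1"
    and "\<forall>i\<in>{1..r}. 0 < q i"
    and "(\<Sum>i = 1..r. q i) = 1"
  shows "let err = (\<lambda>n::nat. opt_error (d ^ n)
                (complex_of_real p \<cdot>\<^sub>m tensor_pow \<rho> n)
                (complex_of_real (1 - p) \<cdot>\<^sub>m mix_tensor_pow d r q \<sigma> n));
             rate = (\<lambda>n::nat. ereal (1 / real n) * elog b (err n));
             C = Min ((\<lambda>i. chernoff_div b d \<rho> (\<sigma> i)) ` {1..r})
         in - C \<le> liminf rate \<and>
            liminf rate \<le> limsup rate \<and>
            limsup rate \<le> - (ereal (1 / 2) * C) \<and>
            (vec_space.rank d \<rho> = 1 \<longrightarrow> rate \<longlonglongrightarrow> - C)"
proof -
  obtain U l where U: "unitary_op d U" "\<rho> = of_spectrum d U l" "\<And>k. 0 \<le> l k"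
    using psd_spectral[of d \<rho>] assms(2) unfolding density_op_def by metis
  have "\<exists>V m. unitary_op d V \<and> \<sigma> i = of_spectrum d V m \<and> (\<forall>k. 0 \<le> m k)" if "i \<in> {1..r}" for i
    using psd_spectral[of d "\<sigma> i"] assms(3) that unfolding density_op_def by metis
  then obtain V m where V: "\<And>i. i \<in> {1..r} \<Longrightarrow> unitary_op d (V i)"
    "\<And>i. i \<in> {1..r} \<Longrightarrow> \<sigma> i = of_spectrum d (V i) (m i)" "\<And>i k. i \<in> {1..r} \<Longrightarrow> 0 \<le> m i k"
    by metis
  have m: "(\<Sum>k<d. m i k) = 1" if i: "i \<in> {1..r}" for i
  proof -
    have "complex_of_real (\<Sum>k<d. m i k) = 1"
      using assms(3) i op_trace_of_spectrum[OF V(1)[OF i], of "m i"] V(2)[OF i]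
      unfolding density_op_def by metis
    then show ?thesis by (simp only: of_real_eq_1_iff)
  qed
  interpret M: mixture_discrimination d r p q U l V m \<sigma>
    using assms U V m by unfold_locales auto
  define rate where "rate = (\<lambda>n. ereal (1 / real n) * elog b (M.err n))"
  define C where "C = Min ((\<lambda>i. chernoff_div b d \<rho> (\<sigma> i)) ` {1..r})"
  \<comment> \<open>The normalization of \<open>q\<close> forces at least one component, so
    \<open>Min\<close> and \<open>Max\<close> below are taken over nonempty sets.\<close>
  have ne: "{1..r} \<noteq> {}" using assms(7) by (metis sum.empty zero_neq_one)
  have "Max (M.chernoff_inf ` {1..r}) \<in> M.chernoff_inf ` {1..r}" using ne by (intro Max_in) auto
  then obtain i where i: "i \<in> {1..r}" "M.chernoff_inf i = Max (M.chernoff_inf ` {1..r})" by auto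
  have max: "M.chernoff_inf j \<le> M.chernoff_inf i" if "j \<in> {1..r}" for j
    unfolding i(2) using that by (intro Max_ge) auto
  \<comment> \<open>The smallest divergence belongs to the largest \<open>chernoff_inf\<close>,
    since \<open>- elog b\<close> is antitone.\<close>
  have C: "C = - elog b (M.chernoff_inf i)"
    unfolding C_def
  proof (rule Min_eqI)
    fix y assume "y \<in> (\<lambda>i. chernoff_div b d \<rho> (\<sigma> i)) ` {1..r}"
    then show "- elog b (M.chernoff_inf i) \<le> y"
      using elog_mono[OF assms(1) max] by (auto simp: U(2) M.chernoff_div_eq)
  qed (use i in \<open>auto simp: U(2) M.chernoff_div_eq intro!: image_eqI[of _ _ i]\<close>)
  note x = M.chernoff_inf_bounds(1,2)[OF i(1)]
  have 1: "- C \<le> liminf rate"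
    using M.liminf_ge_chernoff_inf[OF assms(1) i(1)] by (simp add: C rate_def)
  have 2: "liminf rate \<le> limsup rate" by (intro Liminf_le_Limsup) simp
  \<comment> \<open>For \<open>chernoff_inf i = 0\<close> both sides are minus infinity; otherwise
    the square root halves the logarithm.\<close>
  have "elog b (sqrt (M.chernoff_inf i)) = - (ereal (1 / 2) * C)"
    using x assms(1) by (cases "M.chernoff_inf i = 0") (auto simp: C elog_def log_def ln_sqrt)
  then have 3: "limsup rate \<le> - (ereal (1 / 2) * C)"
    using M.limsup_le_half[OF assms(1) x max] by (simp add: rate_def)
  have 4: "rate \<longlonglongrightarrow> - C" if "vec_space.rank d \<rho> = 1"
  proof -
    have "\<rho> * \<rho> = \<rho>"
      using assms(2) that by (intro rank_one_idempotent) (auto simp: density_op_def psd_def)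
    then have "limsup rate \<le> - C"
      using M.limsup_le_pure[OF assms(1) x(1) max] by (simp add: U(2) C rate_def)
    then show ?thesis
      using 1 2 by (intro Liminf_eq_Limsup) (auto intro: order.antisym order_trans)
  qed
  show ?thesis
    using 1 2 3 4 unfolding rate_def C_def M.err_def U(2)[symmetric] Let_def by blast
qed

end
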